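(* Let $F\in L^1_{loc}(\mathbb{R})$ satisfy $F(s)=0$ for $s<0$ and $\sup_{s\in\mathbb{R}}(1+|s|)^p|F(s)|<\infty$ for some $p\in\mathbb{R}$. Then, for each type of boundary conditions (DD, NN, DN) with the corresponding kernel $Z$, the diffracted wave $u_d$ admits the representation $$u_d(\rho,\theta,t)=\frac{i}{4\Phi}\int_{\mathbb{R}}Z(\beta+i\theta)\,F(t-\rho\cosh\beta)\,d\beta,\qquad \rho>0,\ \theta\in\Theta,\ t\in\mathbb{R}.$$
   Context: Fix $\phi\in(0,\pi)$, $\Phi:=2\pi-\phi$, $q:=\pi/(2\Phi)$, and $\alpha$ with $\max(0,\phi-\pi/2)<\alpha<\min(\pi/2,\phi)$ (standing assumption). Put $\theta_1:=2\phi-\alpha$, $\theta_2:=2\pi-\alpha$, $\Theta:=[\phi,2\pi]\setminus\{\theta_1,\theta_2\}$. Kernel. $H(\beta)=\coth(q(\beta+\tfrac{i\pi}2-i\alpha))\mp\coth(q(\beta-\tfrac{3i\pi}2+i\alpha))$ for DD (upper sign) and NN (lower sign), $H(\beta)=\dfrac1{\sinh(q(\beta+\frac{i\pi}2-i\alpha))}+\dfrac1{\sinh(q(\beta-\frac{3i\pi}2+i\alpha))}$ for DN; $Z(\beta)=-H(\beta-\tfrac{i\pi}2)+H(\beta-\tfrac{5i\pi}2)$. Fourier–Laplace transform: $\hat u(\omega)=\int_{\mathbb{R}}e^{i\omega t}u(t)\,dt$, for (tempered) $u$ supported in $t\ge0$ and $\omega\in\mathbb{C}^+=\{\operatorname{Im}\omega>0\}$.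 Diffracted wave. Let $\mathcal S_d(\rho,\theta,\omega)=\frac{i}{4\Phi}\int_{\mathbb{R}}e^{i\omega\rho\cosh\beta}Z(\beta+i\theta)\,d\beta$ for $\rho>0$, $\theta\in\Theta$, $\omega\in\mathbb{C}^+$. The diffracted wave $u_d$ corresponding to the incident wave $F(t-n_0\cdot y)$, $n_0=(\cos\alpha,\sin\alpha)$, is the inverse Fourier–Laplace transform $u_d(\rho,\theta,\cdot)=\mathcal F^{-1}_{\omega\to t}[\hat F(\omega)\mathcal S_d(\rho,\theta,\omega)]$; the asserted equality is understood as equality of distributions in $t$ for each fixed $(\rho,\theta)$. *)

theory Defs
  imports "HOL-Analysis.Analysis"
begin

definition nth_vderiv :: "nat \<Rightarrow> (real \<Rightarrow> complex) \<Rightarrow> real \<Rightarrow> complex" where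
  "nth_vderiv n = ((\<lambda>g t. vector_derivative g (at t)) ^^ n)"

definition smooth_fun :: "(real \<Rightarrow> complex) \<Rightarrow> bool" where
  "smooth_fun f \<longleftrightarrow> (\<forall>n t. nth_vderiv n f differentiable (at t))"

definition schwartz_space :: "(real \<Rightarrow> complex) set" where
  "schwartz_space = {\<psi>. smooth_fun \<psi> \<and>
     (\<forall>k j. bdd_above (range (\<lambda>t. \<bar>t\<bar> ^ k * norm (nth_vderiv j \<psi> t))))}"

definition schwartz_seminorm :: "nat \<Rightarrow> nat \<Rightarrow> (real \<Rightarrow> complex) \<Rightarrow> real" where
  "schwartz_seminorm k j \<psi> = (SUP t. \<bar>t\<bar> ^ k * norm (nth_vderiv j \<psi> t))"

text \<open>Functionals are extensional (\<open>undefined\<close> off the Schwartz space), so that equality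
  of HOL functions is equality of distributions.\<close>

definition tempered_distribution :: "((real \<Rightarrow> complex) \<Rightarrow> complex) \<Rightarrow> bool" where
  "tempered_distribution u \<longleftrightarrow>
     u \<in> extensional schwartz_space \<and>
     (\<forall>\<psi>\<in>schwartz_space. \<forall>\<zeta>\<in>schwartz_space. u (\<lambda>t. \<psi> t + \<zeta> t) = u \<psi> + u \<zeta>) \<and>
     (\<forall>c. \<forall>\<psi>\<in>schwartz_space. u (\<lambda>t. c * \<psi> t) = c * u \<psi>) \<and>
     (\<exists>C N. \<forall>\<psi>\<in>schwartz_space.
        norm (u \<psi>) \<le> C * (\<Sum>k\<le>N. \<Sum>j\<le>N. schwartz_seminorm k j \<psi>))"

text \<open>For closed \<open>A\<close> this says that the support of \<open>u\<close> is contained in \<open>A\<close>.\<close>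

definition supported_in :: "((real \<Rightarrow> complex) \<Rightarrow> complex) \<Rightarrow> real set \<Rightarrow> bool" where
  "supported_in u A \<longleftrightarrow>
     (\<forall>\<psi>. smooth_fun \<psi> \<and> compact (closure {t. \<psi> t \<noteq> 0}) \<and>
          closure {t. \<psi> t \<noteq> 0} \<inter> A = {} \<longrightarrow> u \<psi> = 0)"

text \<open>\<open>u\<close> is the regular tempered distribution given by the function \<open>G\<close>. Integrability is
  required explicitly because a divergent Bochner integral has the value 0.\<close>

definition given_by_function ::
    "((real \<Rightarrow> complex) \<Rightarrow> complex) \<Rightarrow> (real \<Rightarrow> complex) \<Rightarrow> bool" where
  "given_by_function u G \<longleftrightarrow>
     (\<forall>\<psi>\<in>schwartz_space. integrable lebesgue (\<lambda>t. G t * \<psi> t)) \<and>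
     u = (\<lambda>\<psi>\<in>schwartz_space. LINT t|lebesgue. G t * \<psi> t)"

text \<open>For a measurable \<open>f\<close> of at most polynomial growth that vanishes on \<open>{..<0}\<close>, this integral
  converges for \<open>Im \<omega> > 0\<close> and is the transform of the regular distribution given by \<open>f\<close>.\<close>

definition fourier_laplace_fun :: "(real \<Rightarrow> complex) \<Rightarrow> complex \<Rightarrow> complex" where
  "fourier_laplace_fun f \<omega> = (LINT t|lebesgue. exp (\<i> * \<omega> * of_real t) * f t)"

text \<open>For a tempered distribution \<open>u\<close> supported in \<open>{0..}\<close> and \<open>Im \<omega> > 0\<close>, the pairing of \<open>u\<close>
  with \<open>t \<mapsto> exp (\<i> \<omega> t)\<close> is defined by cutting the exponential off on the negative half-line,
  which makes it a Schwartz function. Two cutoffs differ by a test function with compact support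
  in \<open>{..<0}\<close>, so the value does not depend on the cutoff.\<close>

definition half_line_cutoff :: "(real \<Rightarrow> complex) \<Rightarrow> bool" where
  "half_line_cutoff \<kappa> \<longleftrightarrow> smooth_fun \<kappa> \<and> (\<exists>\<epsilon>>0. \<forall>t>-\<epsilon>. \<kappa> t = 1) \<and> (\<exists>a. \<forall>t<a. \<kappa> t = 0)"

definition fourier_laplace :: "((real \<Rightarrow> complex) \<Rightarrow> complex) \<Rightarrow> complex \<Rightarrow> complex" where
  "fourier_laplace u \<omega> =
     (THE c. \<forall>\<kappa>. half_line_cutoff \<kappa> \<longrightarrow> u (\<lambda>t. \<kappa> t * exp (\<i> * \<omega> * of_real t)) = c)"

definition inverse_fourier_laplace ::
    "(complex \<Rightarrow> complex) \<Rightarrow> (real \<Rightarrow> complex) \<Rightarrow> complex" where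
  "inverse_fourier_laplace g =
     (THE u. tempered_distribution u \<and> supported_in u {0..} \<and>
             (\<forall>\<omega>. Im \<omega> > 0 \<longrightarrow> fourier_laplace u \<omega> = g \<omega>))"

text \<open>The wedge has opening angle \<open>\<phi>\<close>; the incident wave is \<open>F (t - n\<^sub>0 \<bullet> y)\<close> with
  \<open>n\<^sub>0 = (cos \<alpha>, sin \<alpha>)\<close>.\<close>

datatype boundary_type = DD | NN | DN

definition wedge_Phi :: "real \<Rightarrow> real" where
  "wedge_Phi \<phi> = 2 * pi - \<phi>"

definition wedge_q :: "real \<Rightarrow> real" where
  "wedge_q \<phi> = pi / (2 * wedge_Phi \<phi>)"

definition wedge_Theta :: "real \<Rightarrow> real \<Rightarrow> real set" where
  "wedge_Theta \<phi> \<alpha> = {\<phi>..2 * pi} - {2 * \<phi> - \<alpha>, 2 * pi - \<alpha>}"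

definition coth :: "complex \<Rightarrow> complex" where
  "coth z = cosh z / sinh z"

fun kernel_H :: "boundary_type \<Rightarrow> real \<Rightarrow> real \<Rightarrow> complex \<Rightarrow> complex" where
  "kernel_H DD \<phi> \<alpha> \<beta> =
     coth (of_real (wedge_q \<phi>) * (\<beta> + \<i> * of_real pi / 2 - \<i> * of_real \<alpha>))
     - coth (of_real (wedge_q \<phi>) * (\<beta> - 3 * \<i> * of_real pi / 2 + \<i> * of_real \<alpha>))"
| "kernel_H NN \<phi> \<alpha> \<beta> =
     coth (of_real (wedge_q \<phi>) * (\<beta> + \<i> * of_real pi / 2 - \<i> * of_real \<alpha>))
     + coth (of_real (wedge_q \<phi>) * (\<beta> - 3 * \<i> * of_real pi / 2 + \<i> * of_real \<alpha>))"
| "kernel_H DN \<phi> \<alpha> \<beta> =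
     1 / sinh (of_real (wedge_q \<phi>) * (\<beta> + \<i> * of_real pi / 2 - \<i> * of_real \<alpha>))
     + 1 / sinh (of_real (wedge_q \<phi>) * (\<beta> - 3 * \<i> * of_real pi / 2 + \<i> * of_real \<alpha>))"

definition kernel_Z :: "boundary_type \<Rightarrow> real \<Rightarrow> real \<Rightarrow> complex \<Rightarrow> complex" where
  "kernel_Z bc \<phi> \<alpha> \<beta> =
     - kernel_H bc \<phi> \<alpha> (\<beta> - \<i> * of_real pi / 2) + kernel_H bc \<phi> \<alpha> (\<beta> - 5 * \<i> * of_real pi / 2)"

definition diffraction_amplitude ::
    "boundary_type \<Rightarrow> real \<Rightarrow> real \<Rightarrow> real \<Rightarrow> real \<Rightarrow> complex \<Rightarrow> complex" where
  "diffraction_amplitude bc \<phi> \<alpha> \<rho> \<theta> \<omega> =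
     \<i> / of_real (4 * wedge_Phi \<phi>) *
     (LINT \<beta>|lebesgue. exp (\<i> * \<omega> * of_real (\<rho> * cosh \<beta>)) *
                       kernel_Z bc \<phi> \<alpha> (of_real \<beta> + \<i> * of_real \<theta>))"

text \<open>For fixed \<open>(\<rho>, \<theta>)\<close> the diffracted wave is a distribution in \<open>t\<close>.\<close>

definition diffracted_wave ::
    "boundary_type \<Rightarrow> real \<Rightarrow> real \<Rightarrow> (real \<Rightarrow> complex) \<Rightarrow> real \<Rightarrow> real \<Rightarrow>
     (real \<Rightarrow> complex) \<Rightarrow> complex" where
  "diffracted_wave bc \<phi> \<alpha> F \<rho> \<theta> =
     inverse_fourier_laplace
       (\<lambda>\<omega>. fourier_laplace_fun F \<omega> * diffraction_amplitude bc \<phi> \<alpha> \<rho> \<theta> \<omega>)"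

end

theory Submission
  imports Defs "HOL-Probability.Sinc_Integral"
begin

text \<open>Substituting \<open>s = t - \<rho> cosh \<beta>\<close>, Fubini gives that the superposition integral has the
  Fourier--Laplace transform required of \<open>u\<^sub>d\<close>: the kernel is bounded on the line \<open>Im = \<theta>\<close> because
  \<open>\<theta>\<close> avoids its poles, and \<open>F\<close> grows at most polynomially, so everything converges absolutely for
  \<open>Im \<omega> > 0\<close>.

  What remains is that a tempered distribution \<open>u\<close> supported in \<open>{0..}\<close> is determined by its
  transform, and the values at \<open>\<omega> = \<i> n\<close> with \<open>n \<ge> 1\<close> suffice: on a half-line, finite sums of
  \<open>exp (- n t)\<close> approximate every Schwartz function in every Schwartz seminorm. To see this, approximate the
  highest derivative by Weierstrass' theorem in the variable \<open>x = exp (- t)\<close>, then integrate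
  repeatedly from \<open>t = \<infinity>\<close>, which keeps the form of the sums.\<close>

section \<open>Smooth functions and the Schwartz space\<close>

text \<open>\<open>inverse_fourier_laplace\<close> is a definite description, so the formula needs
  uniqueness as much as a candidate with the right transform. For uniqueness, the functions
  \<open>exp (- n t)\<close> are not Schwartz, as they grow for t -> -\<infinity>, and they
  approximate only on a half-line. Hence a cutoff \<kappa>, 0 below -1 and 1 above -1/2, splits each
  \<psi> into \<kappa> \<psi>, treated by approximation on t \<ge> -1, and a rest living in t \<le>
  -1/2, treated by the support condition. Errors are weighed by powers of 2 + t, which on t \<ge> -1
  is at least 1 and dominates the absolute value of t.

  For the candidate, the obstacle is measurability: F is only Lebesgue measurable, so neither Fubini
  in (t, \<beta>) nor composition with t - \<rho> cosh \<beta> is immediate. F is replaced by a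
  Borel function that agrees with it off a null set. For every single t the preimage of that null
  set under \<beta> -> t - \<rho> cosh \<beta> is null too, so the resulting formula holds with F
  itself.\<close>

lemma nth_vderiv_0 [simp]: "nth_vderiv 0 f = f"
  by (simp add: nth_vderiv_def)

lemma nth_vderiv_Suc: "nth_vderiv (Suc n) f t = vector_derivative (nth_vderiv n f) (at t)"
  by (simp add: nth_vderiv_def)

lemma has_vderiv_nth_vderiv:
  assumes "smooth_fun f"
  shows "(nth_vderiv n f has_vector_derivative nth_vderiv (Suc n) f t) (at t)"
  using assms by (auto simp: smooth_fun_def nth_vderiv_Suc vector_derivative_works)

text \<open>\<open>vector_derivative\<close> is a choice operator, so iterating it is meaningful
  only where differentiability is known. Exhibiting a whole tower of functions, each the derivative
  of the one before, yields smoothness and the formula for every order at once; the closure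
  properties below are obtained in this way.\<close>

lemma
  assumes "\<And>n t. (g n has_vector_derivative g (Suc n) t) (at t)"
  shows nth_vderiv_eqI: "nth_vderiv n (g 0) = g n"
    and smooth_funI: "smooth_fun (g 0)"
proof -
  show *: "nth_vderiv n (g 0) = g n" for n
  proof (induction n)
    case (Suc n)
    show ?case by (rule ext) (simp add: nth_vderiv_Suc Suc vector_derivative_at[OF assms])
  qed simp
  show "smooth_fun (g 0)"
    using assms by (auto simp: smooth_fun_def * intro: differentiableI_vector)
qed

lemma smooth_fun_nth_vderiv:
  assumes "smooth_fun f"
  shows "smooth_fun (nth_vderiv n f)" "nth_vderiv m (nth_vderiv n f) = nth_vderiv (m + n) f"
proof -
  have *: "(nth_vderiv (k + n) f has_vector_derivative nth_vderiv (Suc k + n) f t) (at t)" for k t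
    using has_vderiv_nth_vderiv[OF assms, of "k + n"] by simp
  show "smooth_fun (nth_vderiv n f)"
    using smooth_funI[of "\<lambda>k. nth_vderiv (k + n) f", OF *] by simp
  show "nth_vderiv m (nth_vderiv n f) = nth_vderiv (m + n) f"
    using nth_vderiv_eqI[of "\<lambda>k. nth_vderiv (k + n) f", OF *] by simp
qed

lemma continuous_on_nth_vderiv: "smooth_fun f \<Longrightarrow> continuous_on A (nth_vderiv n f)"
  by (meson continuous_at_imp_continuous_on has_vderiv_nth_vderiv has_vector_derivative_continuous)

lemma continuous_on_smooth_fun: "smooth_fun f \<Longrightarrow> continuous_on A f"
  using continuous_on_nth_vderiv[of f A 0] by simp

lemma
  assumes "smooth_fun f" "smooth_fun g"
  shows smooth_fun_add: "smooth_fun (\<lambda>t. f t + g t)"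
    and nth_vderiv_add: "nth_vderiv n (\<lambda>t. f t + g t) = (\<lambda>t. nth_vderiv n f t + nth_vderiv n g t)"
proof -
  let ?h = "\<lambda>n t. nth_vderiv n f t + nth_vderiv n g t"
  have *: "(?h n has_vector_derivative ?h (Suc n) t) (at t)" for n t
    by (intro has_vector_derivative_add has_vderiv_nth_vderiv assms)
  show "smooth_fun (\<lambda>t. f t + g t)" using smooth_funI[of ?h, OF *] by simp
  show "nth_vderiv n (\<lambda>t. f t + g t) = ?h n" using nth_vderiv_eqI[of ?h, OF *] by simp
qed

lemma
  assumes "smooth_fun f"
  shows smooth_fun_cmult: "smooth_fun (\<lambda>t. c * f t)"
    and nth_vderiv_cmult: "nth_vderiv n (\<lambda>t. c * f t) = (\<lambda>t. c * nth_vderiv n f t)"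
proof -
  let ?h = "\<lambda>n t. c * nth_vderiv n f t"
  have *: "(?h n has_vector_derivative ?h (Suc n) t) (at t)" for n t
    by (intro has_vector_derivative_mult_right has_vderiv_nth_vderiv assms)
  show "smooth_fun (\<lambda>t. c * f t)" using smooth_funI[of ?h, OF *] by simp
  show "nth_vderiv n (\<lambda>t. c * f t) = ?h n" using nth_vderiv_eqI[of ?h, OF *] by simp
qed

text \<open>An integer slope can be read both as a real and as a complex number, which avoids
  coercions; the slopes that occur are 1 and -1.\<close>

lemma
  assumes "smooth_fun f"
  shows smooth_fun_affine: "smooth_fun (\<lambda>t. f (of_int s * t + c))"
    and nth_vderiv_affine:
      "nth_vderiv n (\<lambda>t. f (of_int s * t + c)) = (\<lambda>t. of_int s ^ n * nth_vderiv n f (of_int s * t + c))"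
proof -
  let ?h = "\<lambda>n t. of_int s ^ n * nth_vderiv n f (of_int s * t + c)"
  have *: "(?h n has_vector_derivative ?h (Suc n) t) (at t)" for n t
  proof -
    have "((\<lambda>t. of_int s * t + c) has_vector_derivative of_int s) (at t)"
      by (auto intro!: derivative_eq_intros)
    then have "(nth_vderiv n f \<circ> (\<lambda>t. of_int s * t + c) has_vector_derivative
       of_int s *\<^sub>R nth_vderiv (Suc n) f (of_int s * t + c)) (at t)"
      by (rule vector_diff_chain_at) (rule has_vderiv_nth_vderiv[OF assms])
    from has_vector_derivative_mult_right[OF this, of "of_int s ^ n"] show ?thesis
      by (simp add: o_def scaleR_conv_of_real mult_ac)
  qed
  show "smooth_fun (\<lambda>t. f (of_int s * t + c))" using smooth_funI[of ?h, OF *] by simp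
  show "nth_vderiv n (\<lambda>t. f (of_int s * t + c)) = ?h n" using nth_vderiv_eqI[of ?h, OF *] by simp
qed

lemma
  shows smooth_fun_const: "smooth_fun (\<lambda>t. c)"
    and nth_vderiv_const: "nth_vderiv n (\<lambda>t. c) = (\<lambda>t. if n = 0 then c else 0)"
proof -
  let ?h = "\<lambda>n t. if n = 0 then c else 0"
  have *: "(?h n has_vector_derivative ?h (Suc n) t) (at t)" for n and t :: real
    by (auto intro!: derivative_eq_intros)
  show "smooth_fun (\<lambda>t. c)" using smooth_funI[of ?h, OF *] by simp
  show "nth_vderiv n (\<lambda>t. c) = ?h n" using nth_vderiv_eqI[of ?h, OF *] by simp
qed

lemma
  shows smooth_fun_exp: "smooth_fun (\<lambda>t. exp (z * of_real t))"
    and nth_vderiv_exp: "nth_vderiv n (\<lambda>t. exp (z * of_real t)) = (\<lambda>t. z ^ n * exp (z * of_real t))"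
proof -
  let ?h = "\<lambda>n t. z ^ n * exp (z * of_real t)"
  have *: "(?h n has_vector_derivative ?h (Suc n) t) (at t)" for n and t :: real
  proof -
    have "((\<lambda>w. z ^ n * exp (z * w)) has_field_derivative z ^ Suc n * exp (z * of_real t)) (at (of_real t))"
      by (auto intro!: derivative_eq_intros)
    from has_vector_derivative_real_field[OF this] show ?thesis by simp
  qed
  show "smooth_fun (\<lambda>t. exp (z * of_real t))" using smooth_funI[of ?h, OF *] by simp
  show "nth_vderiv n (\<lambda>t. exp (z * of_real t)) = ?h n" using nth_vderiv_eqI[of ?h, OF *] by simp
qed

text \<open>Openness provides equality near each point, which is what every further differentiation
  consumes. This is how vanishing or constancy on a region passes to all derivatives.\<close>

lemma nth_vderiv_cong_open:
  assumes "open S" "\<And>s. s \<in> S \<Longrightarrow> f s = g s" "t \<in> S"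
  shows "nth_vderiv n f t = nth_vderiv n g t"
  using assms(3)
proof (induction n arbitrary: t)
  case (Suc n)
  have "\<forall>\<^sub>F s in nhds t. nth_vderiv n f s = nth_vderiv n g s"
    using Suc assms(1) unfolding eventually_nhds by blast
  then show ?case
    unfolding nth_vderiv_Suc by (intro vector_derivative_cong_eq) (auto simp: Suc eventually_at_filter elim: eventually_mono)
qed (use assms in auto)

text \<open>The \<open>n\<close>-th derivative of the product of \<open>nth_vderiv i f\<close> and \<open>nth_vderiv j g\<close>. Organising the
  Leibniz sum as a recursion yields bounds without binomial coefficients.\<close>

fun leibniz :: "(real \<Rightarrow> complex) \<Rightarrow> (real \<Rightarrow> complex) \<Rightarrow> nat \<Rightarrow> nat \<Rightarrow> nat \<Rightarrow> real \<Rightarrow> complex" where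
  "leibniz f g 0 i j t = nth_vderiv i f t * nth_vderiv j g t"
| "leibniz f g (Suc n) i j t = leibniz f g n (Suc i) j t + leibniz f g n i (Suc j) t"

lemma has_vderiv_leibniz:
  assumes "smooth_fun f" "smooth_fun g"
  shows "(leibniz f g n i j has_vector_derivative leibniz f g (Suc n) i j t) (at t)"
proof (induction n arbitrary: i j)
  case 0
  have "((\<lambda>t. nth_vderiv i f t * nth_vderiv j g t) has_vector_derivative
      nth_vderiv i f t * nth_vderiv (Suc j) g t + nth_vderiv (Suc i) f t * nth_vderiv j g t) (at t)"
    by (intro has_vector_derivative_mult has_vderiv_nth_vderiv assms)
  then show ?case by (simp add: add.commute)
next
  case (Suc n)
  show ?case using has_vector_derivative_add[OF Suc[of "Suc i" j] Suc[of i "Suc j"]] by simp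
qed

lemma
  assumes "smooth_fun f" "smooth_fun g"
  shows smooth_fun_mult: "smooth_fun (\<lambda>t. f t * g t)"
    and nth_vderiv_mult: "nth_vderiv n (\<lambda>t. f t * g t) = leibniz f g n 0 0"
proof -
  have "leibniz f g 0 0 0 = (\<lambda>t. f t * g t)" by auto
  then show "smooth_fun (\<lambda>t. f t * g t)" "nth_vderiv n (\<lambda>t. f t * g t) = leibniz f g n 0 0"
    using smooth_funI[of "\<lambda>n. leibniz f g n 0 0", OF has_vderiv_leibniz[OF assms]]
      nth_vderiv_eqI[of "\<lambda>n. leibniz f g n 0 0", OF has_vderiv_leibniz[OF assms]] by auto
qed

lemma norm_leibniz_le:
  assumes "\<And>k. k \<le> i + n \<Longrightarrow> norm (nth_vderiv k f t) \<le> A"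
    and "\<And>k. k \<le> j + n \<Longrightarrow> norm (nth_vderiv k g t) \<le> B"
  shows "norm (leibniz f g n i j t) \<le> 2 ^ n * A * B"
  using assms
proof (induction n arbitrary: i j)
  case 0
  have "0 \<le> A" using order_trans[OF norm_ge_zero 0(1)[of i]] by simp
  then show ?case using 0 by (auto simp: norm_mult intro!: mult_mono)
next
  case (Suc n)
  have "norm (leibniz f g n (Suc i) j t) \<le> 2 ^ n * A * B" "norm (leibniz f g n i (Suc j) t) \<le> 2 ^ n * A * B"
    by (intro Suc; simp)+
  then show ?case by (auto intro: norm_triangle_le)
qed

lemma norm_nth_vderiv_mult_le:
  assumes "smooth_fun f" "smooth_fun g"
    and "\<And>k. k \<le> n \<Longrightarrow> norm (nth_vderiv k f t) \<le> A"
    and "\<And>k. k \<le> n \<Longrightarrow> norm (nth_vderiv k g t) \<le> B"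
  shows "norm (nth_vderiv n (\<lambda>t. f t * g t) t) \<le> 2 ^ n * A * B"
  unfolding nth_vderiv_mult[OF assms(1,2)]
  using assms(3,4) norm_leibniz_le[of 0 n f t A 0 g B] by simp

section \<open>Schwartz seminorms and concrete Schwartz functions\<close>

lemma schwartz_smooth: "\<psi> \<in> schwartz_space \<Longrightarrow> smooth_fun \<psi>"
  by (simp add: schwartz_space_def)

lemma schwartz_seminorm_ge:
  assumes "\<psi> \<in> schwartz_space"
  shows "\<bar>t\<bar> ^ k * norm (nth_vderiv j \<psi> t) \<le> schwartz_seminorm k j \<psi>"
  unfolding schwartz_seminorm_def using assms by (intro cSUP_upper) (auto simp: schwartz_space_def)

lemma schwartz_seminorm_nonneg: "\<psi> \<in> schwartz_space \<Longrightarrow> 0 \<le> schwartz_seminorm k j \<psi>"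
  by (rule order_trans[OF _ schwartz_seminorm_ge[of _ 0]]) auto

lemma schwartz_seminorm_le:
  assumes "\<And>t. \<bar>t\<bar> ^ k * norm (nth_vderiv j \<psi> t) \<le> B"
  shows "schwartz_seminorm k j \<psi> \<le> B"
  unfolding schwartz_seminorm_def by (intro cSUP_least) (use assms in auto)

lemma schwartzI:
  assumes "smooth_fun \<psi>" "\<And>k j. \<exists>B. \<forall>t. \<bar>t\<bar> ^ k * norm (nth_vderiv j \<psi> t) \<le> B"
  shows "\<psi> \<in> schwartz_space"
  using assms by (auto simp: schwartz_space_def bdd_above_def)

text \<open>The weight is at most \<open>(2 * max 1 \<bar>t\<bar>) ^ k\<close>, and a maximum of two
  powers is bounded by their sum; hence just two seminorms.\<close>

lemma schwartz_weight_le: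
  assumes "\<psi> \<in> schwartz_space"
  shows "(1 + \<bar>t\<bar>) ^ k * norm (nth_vderiv j \<psi> t)
    \<le> 2 ^ k * (schwartz_seminorm 0 j \<psi> + schwartz_seminorm k j \<psi>)"
proof -
  have "(1 + \<bar>t\<bar>) ^ k \<le> (2 * max 1 \<bar>t\<bar>) ^ k" by (intro power_mono) auto
  also have "\<dots> \<le> 2 ^ k * (\<bar>t\<bar> ^ 0 + \<bar>t\<bar> ^ k)"
    by (cases "\<bar>t\<bar> \<le> 1") (auto simp: power_mult_distrib max_def)
  finally have "(1 + \<bar>t\<bar>) ^ k * norm (nth_vderiv j \<psi> t) \<le>
     2 ^ k * (\<bar>t\<bar> ^ 0 * norm (nth_vderiv j \<psi> t) + \<bar>t\<bar> ^ k * norm (nth_vderiv j \<psi> t))"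
    by (metis distrib_right mult.assoc mult_right_mono norm_ge_zero)
  also have "\<dots> \<le> 2 ^ k * (schwartz_seminorm 0 j \<psi> + schwartz_seminorm k j \<psi>)"
    by (intro mult_left_mono add_mono schwartz_seminorm_ge assms) auto
  finally show ?thesis .
qed

lemma schwartz_add:
  assumes "\<psi> \<in> schwartz_space" "\<zeta> \<in> schwartz_space"
  shows "(\<lambda>t. \<psi> t + \<zeta> t) \<in> schwartz_space"
proof (rule schwartzI)
  show "smooth_fun (\<lambda>t. \<psi> t + \<zeta> t)" using assms by (intro smooth_fun_add schwartz_smooth)
  fix k j
  have "\<bar>t\<bar> ^ k * norm (nth_vderiv j (\<lambda>t. \<psi> t + \<zeta> t) t) \<le> schwartz_seminorm k j \<psi> + schwartz_seminorm k j \<zeta>" for t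
  proof -
    have "\<bar>t\<bar> ^ k * norm (nth_vderiv j (\<lambda>t. \<psi> t + \<zeta> t) t)
        \<le> \<bar>t\<bar> ^ k * norm (nth_vderiv j \<psi> t) + \<bar>t\<bar> ^ k * norm (nth_vderiv j \<zeta> t)"
      unfolding nth_vderiv_add[OF assms[THEN schwartz_smooth]] distrib_left[symmetric]
      by (intro mult_left_mono norm_triangle_ineq) auto
    then show ?thesis using schwartz_seminorm_ge[OF assms(1), of t k j] schwartz_seminorm_ge[OF assms(2), of t k j] by linarith
  qed
  then show "\<exists>B. \<forall>t. \<bar>t\<bar> ^ k * norm (nth_vderiv j (\<lambda>t. \<psi> t + \<zeta> t) t) \<le> B" by blast
qed

lemma schwartz_cmult:
  assumes "\<psi> \<in> schwartz_space"
  shows "(\<lambda>t. c * \<psi> t) \<in> schwartz_space"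
proof (rule schwartzI)
  show "smooth_fun (\<lambda>t. c * \<psi> t)" using assms by (intro smooth_fun_cmult schwartz_smooth)
  fix k j
  have "\<bar>t\<bar> ^ k * norm (nth_vderiv j (\<lambda>t. c * \<psi> t) t) \<le> norm c * schwartz_seminorm k j \<psi>" for t
    using mult_left_mono[OF schwartz_seminorm_ge[OF assms, of t k j], of "norm c"]
    by (simp add: nth_vderiv_cmult[OF assms[THEN schwartz_smooth]] norm_mult mult_ac)
  then show "\<exists>B. \<forall>t. \<bar>t\<bar> ^ k * norm (nth_vderiv j (\<lambda>t. c * \<psi> t) t) \<le> B" by blast
qed

lemma bounded_upto:
  fixes f :: "nat \<Rightarrow> 'a \<Rightarrow> real"
  assumes "\<And>k. \<exists>B. \<forall>t. f k t \<le> B"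
  obtains B where "B \<ge> 0" "\<And>k t. k \<le> n \<Longrightarrow> f k t \<le> B"
proof -
  obtain b where b: "\<And>k t. f k t \<le> b k" using assms by metis
  have "f k t \<le> (\<Sum>i\<le>n. \<bar>b i\<bar>)" if "k \<le> n" for k t
  proof -
    have "f k t \<le> \<bar>b k\<bar>" using b[of k t] by linarith
    also have "\<dots> \<le> (\<Sum>i\<le>n. \<bar>b i\<bar>)" by (rule member_le_sum) (use that in auto)
    finally show ?thesis .
  qed
  then show thesis by (intro that[of "\<Sum>i\<le>n. \<bar>b i\<bar>"]) (auto intro: sum_nonneg)
qed

text \<open>The set S allows a factor g that decays only where f lives: the model case is
  \<open>exp (\<i> * \<omega> * t)\<close>, which blows up as t -> -\<infinity>, times a cutoff that
  vanishes there. Openness of the complement makes the derivatives of the product vanish off S as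
  well.\<close>

lemma schwartz_mult_bounded:
  assumes "smooth_fun f" "smooth_fun g"
    and f: "\<And>j. \<exists>B. \<forall>t. norm (nth_vderiv j f t) \<le> B"
    and g: "\<And>k j. \<exists>B. \<forall>t\<in>S. \<bar>t\<bar> ^ k * norm (nth_vderiv j g t) \<le> B"
    and S: "open (- S)" "\<And>t. t \<notin> S \<Longrightarrow> f t = 0"
  shows "(\<lambda>t. f t * g t) \<in> schwartz_space"
proof (rule schwartzI)
  show "smooth_fun (\<lambda>t. f t * g t)" using assms by (intro smooth_fun_mult)
  fix k j
  obtain A where A: "A \<ge> 0" "\<And>i t. i \<le> j \<Longrightarrow> norm (nth_vderiv i f t) \<le> A"
    using bounded_upto[of "\<lambda>i t. norm (nth_vderiv i f t)" j] f by metis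
  have "\<exists>B. \<forall>t. (if t \<in> S then \<bar>t\<bar> ^ k * norm (nth_vderiv j g t) else 0) \<le> B" for j
  proof -
    obtain B where "\<forall>t\<in>S. \<bar>t\<bar> ^ k * norm (nth_vderiv j g t) \<le> B" using g by blast
    then show ?thesis by (intro exI[of _ "max B 0"]) (auto simp: le_max_iff_disj)
  qed
  from bounded_upto[of "\<lambda>j t. (if t \<in> S then \<bar>t\<bar> ^ k * norm (nth_vderiv j g t) else 0)" j, OF this]
  obtain B where B: "B \<ge> 0" "\<And>i t. i \<le> j \<Longrightarrow> (if t \<in> S then \<bar>t\<bar> ^ k * norm (nth_vderiv i g t) else 0) \<le> B"
    by metis
  have "\<bar>t\<bar> ^ k * norm (nth_vderiv j (\<lambda>t. f t * g t) t) \<le> 2 ^ j * A * B" for t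
  proof (cases "t \<in> S")
    case False
    have "nth_vderiv j (\<lambda>t. f t * g t) t = nth_vderiv j (\<lambda>t. 0) t"
      by (rule nth_vderiv_cong_open[OF S(1)]) (use S(2) False in auto)
    then show ?thesis using A B by (simp add: nth_vderiv_const)
  next
    case True
    \<comment> \<open>Dividing by the weight turns the weighted bounds on g into plain ones, to
      which the Leibniz estimate applies. If the weight is 0, the claim is trivial.\<close>
    show ?thesis
    proof (cases "\<bar>t\<bar> ^ k = 0")
      case z: True
      then show ?thesis unfolding z using mult_nonneg_nonneg[OF A(1) B(1)] by (simp add: mult.assoc)
    next
      case False
      then have pos: "\<bar>t\<bar> ^ k > 0" by (metis abs_ge_zero order_le_imp_less_or_eq zero_le_power)
      have "norm (nth_vderiv j (\<lambda>t. f t * g t) t) \<le> 2 ^ j * A * (B / \<bar>t\<bar> ^ k)"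
      proof (rule norm_nth_vderiv_mult_le[OF assms(1,2) A(2)])
        show "norm (nth_vderiv i g t) \<le> B / \<bar>t\<bar> ^ k" if "i \<le> j" for i
          using B(2)[OF that, of t] True pos by (simp add: pos_le_divide_eq mult.commute)
      qed
      then have "norm (nth_vderiv j (\<lambda>t. f t * g t) t) \<le> (2 ^ j * A * B) / \<bar>t\<bar> ^ k" by simp
      then show ?thesis unfolding pos_le_divide_eq[OF pos] by (simp only: mult.commute)
    qed
  qed
  then show "\<exists>B. \<forall>t. \<bar>t\<bar> ^ k * norm (nth_vderiv j (\<lambda>t. f t * g t) t) \<le> B" by blast
qed

lemma schwartz_smooth_mult:
  assumes "smooth_fun f" "\<And>j. \<exists>B. \<forall>t. norm (nth_vderiv j f t) \<le> B" "\<psi> \<in> schwartz_space"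
  shows "(\<lambda>t. f t * \<psi> t) \<in> schwartz_space"
proof (rule schwartz_mult_bounded[where S = UNIV])
  show "\<exists>B. \<forall>t\<in>UNIV. \<bar>t\<bar> ^ k * norm (nth_vderiv j \<psi> t) \<le> B" for k j
    using schwartz_seminorm_ge[OF assms(3)] by blast
qed (use assms in \<open>auto simp: schwartz_smooth\<close>)

text \<open>Outside \<open>{a..0}\<close> the cutoff is locally constant, and on that compact
  interval its derivatives are continuous.\<close>

lemma half_line_cutoff_bounded:
  assumes "half_line_cutoff \<kappa>"
  shows "\<exists>B. \<forall>t. norm (nth_vderiv j \<kappa> t) \<le> B"
proof -
  from assms obtain \<epsilon> a where \<kappa>: "smooth_fun \<kappa>" "\<epsilon> > 0" "\<And>t. t > -\<epsilon> \<Longrightarrow> \<kappa> t = 1" "\<And>t. t < a \<Longrightarrow> \<kappa> t = 0"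
    by (auto simp: half_line_cutoff_def)
  have "compact (nth_vderiv j \<kappa> ` {a..0})"
    by (intro compact_continuous_image continuous_on_nth_vderiv \<kappa>) auto
  then obtain B where B: "\<And>t. t \<in> {a..0} \<Longrightarrow> norm (nth_vderiv j \<kappa> t) \<le> B"
    by (meson bounded_iff compact_imp_bounded imageI)
  have "norm (nth_vderiv j \<kappa> t) \<le> max B 1" for t
  proof -
    consider "t < a" | "t \<in> {a..0}" | "t > -\<epsilon>" using \<kappa>(2) by force
    then show ?thesis
    proof cases
      case 1
      have "nth_vderiv j \<kappa> t = nth_vderiv j (\<lambda>t. 0) t"
        by (rule nth_vderiv_cong_open[of "{..<a}"]) (use 1 \<kappa> in auto)
      then show ?thesis by (simp add: nth_vderiv_const)
    next
      case 3
      have "nth_vderiv j \<kappa> t = nth_vderiv j (\<lambda>t. 1) t"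
        by (rule nth_vderiv_cong_open[of "{-\<epsilon><..}"]) (use 3 \<kappa> in auto)
      then show ?thesis by (simp add: nth_vderiv_const le_max_iff_disj)
    qed (use B in \<open>simp add: le_max_iff_disj\<close>)
  qed
  then show ?thesis by blast
qed

text \<open>One term of the exponential series is at most the whole: x^k / k! \<le> exp x for x = c
  (1 + \<bar>t\<bar>). The other ingredient is 1 + \<bar>t\<bar> \<le> 1 + 2 \<bar>a\<bar> + t for t
  \<ge> a.\<close>

lemma power_exp_bounded:
  fixes c a :: real
  assumes "c > 0"
  shows "\<exists>B. \<forall>t\<ge>a. (1 + \<bar>t\<bar>) ^ k * exp (- c * t) \<le> B"
proof -
  have "(1 + \<bar>t\<bar>) ^ k * exp (- c * t) \<le> fact k * exp (c * (1 + 2 * \<bar>a\<bar>)) / c ^ k" if "t \<ge> a" for t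
  proof -
    have "(c * (1 + \<bar>t\<bar>)) ^ k / fact k \<le> exp (c * (1 + \<bar>t\<bar>))"
    proof -
      let ?x = "c * (1 + \<bar>t\<bar>)"
      have "(\<Sum>n\<in>{k}. ?x ^ n /\<^sub>R fact n) \<le> exp ?x"
        unfolding exp_def using assms by (intro sum_le_suminf summable_exp_generic) auto
      then show ?thesis by (simp add: field_simps)
    qed
    also have "\<dots> \<le> exp (c * (1 + 2 * \<bar>a\<bar>) + c * t)"
    proof -
      have "1 + \<bar>t\<bar> \<le> (1 + 2 * \<bar>a\<bar>) + t" using that by linarith
      from mult_left_mono[OF this, of c] show ?thesis using assms by (simp add: algebra_simps)
    qed
    finally have "c ^ k * (1 + \<bar>t\<bar>) ^ k / fact k \<le> exp (c * (1 + 2 * \<bar>a\<bar>)) * exp (c * t)"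
      unfolding power_mult_distrib exp_add .
    moreover have "exp (- c * t) = 1 / exp (c * t)" by (simp add: exp_minus field_simps)
    moreover have "p * (1 / e) \<le> f * E / d" if "d * p / f \<le> E * e" "d > 0" "f > 0" "e > 0" for p e f E d :: real
      using that by (simp add: field_simps)
    ultimately show ?thesis using assms by simp
  qed
  then show ?thesis by blast
qed

lemma cutoff_exp_schwartz:
  assumes "half_line_cutoff \<kappa>" "Im \<omega> > 0"
  shows "(\<lambda>t. \<kappa> t * exp (\<i> * \<omega> * of_real t)) \<in> schwartz_space"
proof -
  from assms(1) obtain a where \<kappa>: "smooth_fun \<kappa>" "\<And>t. t < a \<Longrightarrow> \<kappa> t = 0"
    by (auto simp: half_line_cutoff_def)
  show ?thesis
  proof (rule schwartz_mult_bounded[where S = "{a..}"])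
    fix k j
    obtain B where B: "\<And>t. t \<ge> a \<Longrightarrow> (1 + \<bar>t\<bar>) ^ k * exp (- Im \<omega> * t) \<le> B"
      using power_exp_bounded[OF assms(2), of a k] by blast
    have "\<bar>t\<bar> ^ k * norm (nth_vderiv j (\<lambda>t. exp (\<i> * \<omega> * of_real t)) t) \<le> norm \<omega> ^ j * B" if "t \<ge> a" for t
    proof -
      have "\<bar>t\<bar> ^ k * exp (- Im \<omega> * t) \<le> (1 + \<bar>t\<bar>) ^ k * exp (- Im \<omega> * t)"
        by (intro mult_right_mono power_mono) auto
      also have "\<dots> \<le> B" by (rule B[OF that])
      finally have "norm \<omega> ^ j * (\<bar>t\<bar> ^ k * exp (- Im \<omega> * t)) \<le> norm \<omega> ^ j * B"
        by (intro mult_left_mono) auto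
      moreover have "norm (nth_vderiv j (\<lambda>t. exp (\<i> * \<omega> * of_real t)) t) = norm \<omega> ^ j * exp (- Im \<omega> * t)"
        unfolding nth_vderiv_exp by (simp add: norm_mult norm_power)
      ultimately show ?thesis by (simp add: mult_ac)
    qed
    then show "\<exists>B. \<forall>t\<in>{a..}. \<bar>t\<bar> ^ k * norm (nth_vderiv j (\<lambda>t. exp (\<i> * \<omega> * of_real t)) t) \<le> B" by auto
  next
    show "\<exists>B. \<forall>t. norm (nth_vderiv j \<kappa> t) \<le> B" for j
      by (rule half_line_cutoff_bounded[OF assms(1)])
    show "smooth_fun (\<lambda>t. exp (\<i> * \<omega> * of_real t))" by (rule smooth_fun_exp)
    show "open (- {a..})" by simp
  qed (simp_all add: \<kappa>)
qed

text \<open>\<open>supported_in\<close> evaluates functionals at compactly supported test functions;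
  restricted functionals take their intended value there only because these functions lie in
  \<open>schwartz_space\<close>.\<close>

lemma compact_support_schwartz:
  assumes "smooth_fun \<psi>" "compact (closure {t. \<psi> t \<noteq> 0})"
  shows "\<psi> \<in> schwartz_space"
proof (rule schwartzI)
  fix k j
  let ?S = "closure {t. \<psi> t \<noteq> 0}"
  let ?g = "\<lambda>t. \<bar>t\<bar> ^ k * norm (nth_vderiv j \<psi> t)"
  have "compact (?g ` ?S)"
    by (intro compact_continuous_image continuous_intros continuous_on_nth_vderiv assms)
  then obtain B where B: "\<And>t. t \<in> ?S \<Longrightarrow> norm (?g t) \<le> B"
    by (meson bounded_iff compact_imp_bounded imageI)
  have "?g t \<le> max B 0" for t
  proof (cases "t \<in> ?S")
    case False
    have "nth_vderiv j \<psi> t = nth_vderiv j (\<lambda>t. 0) t"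
      by (rule nth_vderiv_cong_open[of "- ?S"]) (use False closure_subset[of "{t. \<psi> t \<noteq> 0}"] in auto)
    then show ?thesis by (simp add: nth_vderiv_const)
  qed (use B[of t] in auto)
  then show "\<exists>B. \<forall>t. ?g t \<le> B" by blast
qed fact

section \<open>Cutoffs and tempered distributions\<close>

text \<open>For x > 0 the n-th derivative of exp (-1/x) has the form P(y) exp (-y) with y = 1/x.
  Differentiating in x once more gives y^2 (P(y) - P'(y)) exp (-y), which is the recursion;
  \<open>[:0, 0, 1:]\<close> is y^2.\<close>

fun flat_poly :: "nat \<Rightarrow> real poly" where
  "flat_poly 0 = 1"
| "flat_poly (Suc n) = [:0, 0, 1:] * (flat_poly n - pderiv (flat_poly n))"

definition flat :: "nat \<Rightarrow> real \<Rightarrow> real" where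
  "flat n x = (if x > 0 then poly (flat_poly n) (1 / x) * exp (- 1 / x) else 0)"

text \<open>The free power \<open>x ^ k\<close> makes the induction on coefficients close: splitting
  off the constant term leaves the shorter polynomial with power \<open>Suc k\<close>.\<close>

lemma poly_mult_exp_minus_tendsto_0:
  fixes p :: "real poly"
  shows "((\<lambda>x. x ^ k * poly p x * exp (- x)) \<longlongrightarrow> 0) at_top"
proof (induction p arbitrary: k)
  case (pCons a p)
  have "((\<lambda>x::real. x ^ k / exp x) \<longlongrightarrow> 0) at_top" by (rule tendsto_power_div_exp_0)
  then have "((\<lambda>x. a * (x ^ k / exp x) + x ^ Suc k * poly p x * exp (- x)) \<longlongrightarrow> a * 0 + 0) at_top"
    by (intro tendsto_add tendsto_mult pCons tendsto_const)
  then show ?case by (simp add: exp_minus field_simps)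
qed simp

lemma flat_has_derivative: "(flat n has_real_derivative flat (Suc n) x) (at x)"
proof -
  consider "x > 0" | "x < 0" | "x = 0" by linarith
  then show ?thesis
  proof cases
    case 1
    have "((\<lambda>x. poly (flat_poly n) (1 / x) * exp (- 1 / x)) has_real_derivative flat (Suc n) x) (at x)"
      using 1 by (auto intro!: derivative_eq_intros DERIV_chain2[where f="poly _"] simp: flat_def power2_eq_square field_simps)
    then show ?thesis
      by (rule has_field_derivative_transform_within_open[where S = "{0<..}"]) (use 1 in \<open>auto simp: flat_def\<close>)
  next
    case 2
    have "((\<lambda>x. 0) has_real_derivative flat (Suc n) x) (at x)"
      using 2 by (auto simp: flat_def)
    then show ?thesis
      by (rule has_field_derivative_transform_within_open[where S = "{..<0}"]) (use 2 in \<open>auto simp: flat_def\<close>)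
  next
    case 3
    have "((\<lambda>y. flat n y / y) \<longlongrightarrow> 0) (at_left 0)"
    proof (rule tendsto_eventually)
      show "\<forall>\<^sub>F y in at_left 0. flat n y / y = 0"
        by (auto simp: eventually_at_filter flat_def)
    qed
    \<comment> \<open>Under y = 1/x the difference quotient at 0 becomes x P(x) exp (-x) for x ->
      \<infinity>; the division by y accounts for the power 1.\<close>
    moreover have "((\<lambda>y. flat n y / y) \<longlongrightarrow> 0) (at_right 0)"
      unfolding filterlim_at_right_to_top
    proof (rule Lim_transform_eventually[OF poly_mult_exp_minus_tendsto_0[of 1 "flat_poly n"]])
      show "\<forall>\<^sub>F x in at_top. x ^ 1 * poly (flat_poly n) x * exp (- x) = flat n (inverse x) / inverse x"
        using eventually_gt_at_top[of 0] by eventually_elim (auto simp: flat_def field_simps)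
    qed
    ultimately have "((\<lambda>y. flat n y / y) \<longlongrightarrow> 0) (at 0)" by (rule filterlim_split_at)
    then show ?thesis using 3 by (simp add: has_field_derivative_iff flat_def)
  qed
qed

lemma flat_0: "flat 0 x = (if x > 0 then exp (- 1 / x) else 0)"
  by (simp add: flat_def)

lemma smooth_fun_flat: "smooth_fun (\<lambda>t. complex_of_real (flat 0 t))"
  by (rule smooth_funI[of "\<lambda>n t. complex_of_real (flat n t)"])
    (intro has_vector_derivative_of_real flat_has_derivative)

text \<open>The cutoff is the normalised primitive of a bump: b is smooth, nonnegative and positive
  exactly between -1 and -1/2.\<close>

lemma cutoff_exists:
  obtains \<kappa> where "half_line_cutoff \<kappa>" "\<And>t. t < -1 \<Longrightarrow> \<kappa> t = 0" "\<And>t. t > -1/2 \<Longrightarrow> \<kappa> t = 1"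
proof -
  define b where "b t = flat 0 (t + 1) * flat 0 (- t - 1 / 2)" for t
  have cont: "continuous_on A b" for A
    unfolding b_def
    by (intro continuous_intros continuous_on_compose2[OF DERIV_continuous_on[of UNIV "flat 0"]])
      (auto intro: flat_has_derivative)
  have b0: "b t = 0" if "t \<le> -1 \<or> t \<ge> -1/2" for t
    using that by (auto simp: b_def flat_0)
  have bpos: "b t \<ge> 0" for t by (simp add: b_def flat_0)
  have sb: "smooth_fun (\<lambda>t. complex_of_real (b t))"
    using smooth_fun_mult[OF smooth_fun_affine[OF smooth_fun_flat, of 1 1] smooth_fun_affine[OF smooth_fun_flat, of "-1" "-1/2"]]
    by (simp add: b_def algebra_simps)
  \<comment> \<open>The lower limit -2 lies strictly left of the bump, so B vanishes below -1; for t
    < -2 the interval is empty and the integral is 0 as well.\<close>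
  define B where "B t = integral {-2..t} b" for t
  have int: "b integrable_on {s..t}" for s t by (intro integrable_continuous_real cont)
  have B_left: "B t = 0" if "t < -1" for t
  proof -
    have "integral {-2..t} b = integral {-2..t} (\<lambda>t. 0)"
      by (rule integral_cong) (use b0 that in auto)
    then show ?thesis by (simp add: B_def)
  qed
  have B_right: "B t = B (-1/2)" if "t > -1/2" for t
  proof -
    have "integral {-1/2..t} b = integral {-1/2..t} (\<lambda>t. 0)"
      by (rule integral_cong) (use b0 in auto)
    then show ?thesis
      using Henstock_Kurzweil_Integration.integral_combine[of "-2" "-1/2" t b] that int
      by (simp add: B_def)
  qed
  have "B (-1/2) \<noteq> 0"
  proof -
    have "b (-3/4) > 0" by (simp add: b_def flat_0)
    then show ?thesis unfolding B_def
      by (subst integral_eq_0_iff[OF cont]) (use bpos in \<open>auto intro!: bexI[of _ "-3/4"]\<close>)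
  qed
  \<comment> \<open>For t \<le> -2 there is no interval of integration around t to differentiate on,
    but B is locally 0 there.\<close>
  have B': "(B has_real_derivative b t) (at t)" for t
  proof (cases "t > -2")
    case True
    have "(B has_vector_derivative b t) (at t within {-2..t+1})"
      unfolding B_def by (rule integral_has_vector_derivative[OF cont]) (use True in auto)
    moreover have "at t within {-2..t+1} = at t"
      by (rule at_within_interior) (use True in auto)
    ultimately show ?thesis by (simp add: has_real_derivative_iff_has_vector_derivative)
  next
    case False
    have "((\<lambda>t. 0) has_real_derivative b t) (at t)" using False b0 by auto
    then show ?thesis
      by (rule has_field_derivative_transform_within_open[where S = "{..<-1}"]) (use False B_left in auto)
  qed
  \<comment> \<open>B is put in front of the tower of derivatives of b.\<close>
  define g where "g n t = (case n of 0 \<Rightarrow> complex_of_real (B t)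
    | Suc m \<Rightarrow> nth_vderiv m (\<lambda>t. complex_of_real (b t)) t)" for n t
  have "(g n has_vector_derivative g (Suc n) t) (at t)" for n t
    using has_vector_derivative_of_real[OF B'[of t]] has_vderiv_nth_vderiv[OF sb]
    by (cases n) (auto simp: g_def[abs_def])
  from smooth_funI[of g, OF this] have sB: "smooth_fun (\<lambda>t. complex_of_real (B t))"
    by (simp add: g_def[abs_def])
  define \<kappa> where "\<kappa> t = 1 / complex_of_real (B (-1/2)) * complex_of_real (B t)" for t
  have \<kappa>: "\<And>t. t < -1 \<Longrightarrow> \<kappa> t = 0" "\<And>t. t > -1/2 \<Longrightarrow> \<kappa> t = 1"
    using B_left B_right \<open>B (-1/2) \<noteq> 0\<close> by (auto simp: \<kappa>_def)
  moreover have "smooth_fun \<kappa>"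
    unfolding \<kappa>_def by (rule smooth_fun_cmult[OF sB])
  ultimately have "half_line_cutoff \<kappa>"
    unfolding half_line_cutoff_def by (intro conjI exI[of _ "1/2"] exI[of _ "-1"]) auto
  with \<kappa> show thesis by (intro that)
qed

section \<open>Continuity estimates and supports of tempered distributions\<close>

text \<open>The form in which continuity is used: one common bound e for finitely many weighted
  derivatives. The double sum has (N + 1)^2 terms, and \<bar>C\<bar> guards against a negative
  constant.\<close>

lemma tempered_small:
  assumes "tempered_distribution u"
  obtains C N where "C \<ge> 0" "\<And>\<psi> e. \<psi> \<in> schwartz_space \<Longrightarrow>
     (\<And>k j t. k \<le> N \<Longrightarrow> j \<le> N \<Longrightarrow> \<bar>t\<bar> ^ k * norm (nth_vderiv j \<psi> t) \<le> e) \<Longrightarrow> norm (u \<psi>) \<le> C * e"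
proof -
  from assms obtain C N where CN: "\<And>\<psi>. \<psi> \<in> schwartz_space \<Longrightarrow>
      norm (u \<psi>) \<le> C * (\<Sum>k\<le>N. \<Sum>j\<le>N. schwartz_seminorm k j \<psi>)"
    unfolding tempered_distribution_def by blast
  show thesis
  proof (rule that[of "\<bar>C\<bar> * (real (Suc N) * real (Suc N))" N])
    fix \<psi> e assume \<psi>: "\<psi> \<in> schwartz_space"
      and e: "\<And>k j t. k \<le> N \<Longrightarrow> j \<le> N \<Longrightarrow> \<bar>t\<bar> ^ k * norm (nth_vderiv j \<psi> t) \<le> e"
    have nn: "0 \<le> (\<Sum>k\<le>N. \<Sum>j\<le>N. schwartz_seminorm k j \<psi>)"
      by (intro sum_nonneg schwartz_seminorm_nonneg \<psi>)
    have "norm (u \<psi>) \<le> \<bar>C\<bar> * (\<Sum>k\<le>N. \<Sum>j\<le>N. schwartz_seminorm k j \<psi>)"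
      using CN[OF \<psi>] mult_right_mono[OF abs_ge_self[of C] nn] by linarith
    also have "\<dots> \<le> \<bar>C\<bar> * (\<Sum>k\<le>N. \<Sum>j\<le>N. e)"
      by (intro mult_left_mono sum_mono schwartz_seminorm_le e) auto
    also have "\<dots> = \<bar>C\<bar> * (real (Suc N) * real (Suc N)) * e" by simp
    finally show "norm (u \<psi>) \<le> \<bar>C\<bar> * (real (Suc N) * real (Suc N)) * e" .
  qed simp
qed

lemma tempered_add:
  "tempered_distribution u \<Longrightarrow> \<psi> \<in> schwartz_space \<Longrightarrow> \<zeta> \<in> schwartz_space \<Longrightarrow>
    u (\<lambda>t. \<psi> t + \<zeta> t) = u \<psi> + u \<zeta>"
  by (simp add: tempered_distribution_def)

lemma tempered_cmult:
  "tempered_distribution u \<Longrightarrow> \<psi> \<in> schwartz_space \<Longrightarrow> u (\<lambda>t. c * \<psi> t) = c * u \<psi>"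
  by (simp add: tempered_distribution_def)

lemma tempered_diff:
  assumes "tempered_distribution u" "\<psi> \<in> schwartz_space" "\<zeta> \<in> schwartz_space"
  shows "u (\<lambda>t. \<psi> t - \<zeta> t) = u \<psi> - u \<zeta>"
  using tempered_add[OF assms(1,2) schwartz_cmult[OF assms(3), of "-1"]]
    tempered_cmult[OF assms(1,3), of "-1"] by simp

lemma tempered_distribution_diff:
  assumes u: "tempered_distribution u" and v: "tempered_distribution v"
  shows "tempered_distribution (\<lambda>\<psi>\<in>schwartz_space. u \<psi> - v \<psi>)"
  unfolding tempered_distribution_def
proof (intro conjI ballI allI)
  from u obtain C N where CN: "\<And>\<psi>. \<psi> \<in> schwartz_space \<Longrightarrow>
      norm (u \<psi>) \<le> C * (\<Sum>k\<le>N. \<Sum>j\<le>N. schwartz_seminorm k j \<psi>)"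
    unfolding tempered_distribution_def by blast
  from v obtain D M where DM: "\<And>\<psi>. \<psi> \<in> schwartz_space \<Longrightarrow>
      norm (v \<psi>) \<le> D * (\<Sum>k\<le>M. \<Sum>j\<le>M. schwartz_seminorm k j \<psi>)"
    unfolding tempered_distribution_def by blast
  let ?L = "max N M" and ?s = "\<lambda>N \<psi>. \<Sum>k\<le>N. \<Sum>j\<le>N. schwartz_seminorm k j \<psi>"
  show "\<exists>C N. \<forall>\<psi>\<in>schwartz_space. norm ((\<lambda>\<psi>\<in>schwartz_space. u \<psi> - v \<psi>) \<psi>) \<le> C * ?s N \<psi>"
  proof (intro exI[of _ "\<bar>C\<bar> + \<bar>D\<bar>"] exI[of _ ?L] ballI)
    fix \<psi> assume \<psi>: "\<psi> \<in> schwartz_space"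
    have nn: "0 \<le> ?s K \<psi>" for K by (intro sum_nonneg schwartz_seminorm_nonneg \<psi>)
    have mono: "?s K \<psi> \<le> ?s ?L \<psi>" if "K \<le> ?L" for K
    proof -
      have "?s K \<psi> \<le> (\<Sum>k\<le>K. \<Sum>j\<le>?L. schwartz_seminorm k j \<psi>)"
        by (intro sum_mono sum_mono2) (use that schwartz_seminorm_nonneg[OF \<psi>] in auto)
      also have "\<dots> \<le> ?s ?L \<psi>"
        by (intro sum_mono2) (use that in \<open>auto intro!: sum_nonneg schwartz_seminorm_nonneg \<psi>\<close>)
      finally show ?thesis .
    qed
    have "C * ?s N \<psi> \<le> \<bar>C\<bar> * ?s ?L \<psi>" "D * ?s M \<psi> \<le> \<bar>D\<bar> * ?s ?L \<psi>"
      by (intro mult_mono mono nn; simp)+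
    then show "norm ((\<lambda>\<psi>\<in>schwartz_space. u \<psi> - v \<psi>) \<psi>) \<le> (\<bar>C\<bar> + \<bar>D\<bar>) * ?s ?L \<psi>"
      using CN[OF \<psi>] DM[OF \<psi>] norm_triangle_ineq4[of "u \<psi>" "v \<psi>"] \<psi> by (simp add: distrib_right)
  qed
qed (auto simp: tempered_add[OF u] tempered_add[OF v] tempered_cmult[OF u] tempered_cmult[OF v]
      schwartz_add schwartz_cmult right_diff_distrib)

lemma supported_in_diff:
  assumes "supported_in u A" "supported_in v A"
  shows "supported_in (\<lambda>\<psi>\<in>schwartz_space. u \<psi> - v \<psi>) A"
  using assms unfolding supported_in_def by (auto simp: compact_support_schwartz)

lemma supported_in_eq_0:
  assumes "supported_in u {0..}" "smooth_fun \<psi>" "\<And>t. \<psi> t \<noteq> 0 \<Longrightarrow> a \<le> t \<and> t \<le> b" "b < 0"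
  shows "u \<psi> = 0"
proof -
  have "closure {t. \<psi> t \<noteq> 0} \<subseteq> {a..b}"
    by (rule closure_minimal) (use assms in auto)
  moreover from this have "compact (closure {t. \<psi> t \<noteq> 0})"
    by (metis bounded_closed_interval bounded_subset closed_closure compact_eq_bounded_closed)
  moreover have "{a..b} \<inter> {0..} = {}" using assms(4) by auto
  ultimately have "closure {t. \<psi> t \<noteq> 0} \<inter> {0..} = {}" "compact (closure {t. \<psi> t \<noteq> 0})" by blast+
  then show ?thesis using assms(1,2) by (simp add: supported_in_def)
qed

lemma fourier_laplace_eqI:
  assumes u: "tempered_distribution u" "supported_in u {0..}" and "half_line_cutoff \<kappa>" "Im \<omega> > 0"
  shows "fourier_laplace u \<omega> = u (\<lambda>t. \<kappa> t * exp (\<i> * \<omega> * of_real t))"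
  unfolding fourier_laplace_def
proof (rule the_equality)
  show "\<forall>\<kappa>'. half_line_cutoff \<kappa>' \<longrightarrow> u (\<lambda>t. \<kappa>' t * exp (\<i> * \<omega> * of_real t)) = u (\<lambda>t. \<kappa> t * exp (\<i> * \<omega> * of_real t))"
  proof (intro allI impI)
    fix \<kappa>' assume \<kappa>': "half_line_cutoff \<kappa>'"
    let ?e = "\<lambda>t. exp (\<i> * \<omega> * of_real t)"
    from assms(3) obtain \<epsilon> a where 1: "\<epsilon> > 0" "\<And>t. t > -\<epsilon> \<Longrightarrow> \<kappa> t = 1" "\<And>t. t < a \<Longrightarrow> \<kappa> t = 0"
      by (auto simp: half_line_cutoff_def)
    from \<kappa>' obtain \<epsilon>' a' where 2: "\<epsilon>' > 0" "\<And>t. t > -\<epsilon>' \<Longrightarrow> \<kappa>' t = 1" "\<And>t. t < a' \<Longrightarrow> \<kappa>' t = 0"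
      by (auto simp: half_line_cutoff_def)
    have S: "(\<lambda>t. \<kappa>' t * ?e t) \<in> schwartz_space" "(\<lambda>t. \<kappa> t * ?e t) \<in> schwartz_space"
      by (intro cutoff_exp_schwartz \<kappa>' assms)+
    have "u (\<lambda>t. \<kappa>' t * ?e t - \<kappa> t * ?e t) = 0"
    proof (rule supported_in_eq_0[OF u(2)])
      show "smooth_fun (\<lambda>t. \<kappa>' t * ?e t - \<kappa> t * ?e t)"
        using schwartz_smooth[OF schwartz_add[OF S(1) schwartz_cmult[OF S(2), of "-1"]]] by simp
      \<comment> \<open>Left of both a and a' the two cutoffs are 0, right of both -\<epsilon> and
        -\<epsilon>' they are 1; what remains is a compact interval of negative numbers.\<close>
      show "min a a' \<le> t \<and> t \<le> max (-\<epsilon>) (-\<epsilon>')" if "\<kappa>' t * ?e t - \<kappa> t * ?e t \<noteq> 0" for t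
      proof (rule ccontr)
        assume "\<not> (min a a' \<le> t \<and> t \<le> max (-\<epsilon>) (-\<epsilon>'))"
        then have "\<kappa> t = \<kappa>' t" using 1(2,3)[of t] 2(2,3)[of t] by (auto simp: not_le)
        then show False using that by simp
      qed
    qed (use 1 2 in auto)
    then show "u (\<lambda>t. \<kappa>' t * ?e t) = u (\<lambda>t. \<kappa> t * ?e t)"
      using tempered_diff[OF u(1) S] by simp
  qed
qed (use assms in auto)

section \<open>Approximation by exponential sums\<close>

text \<open>The index starts at 1, so every term decays at infinity and is, up to a cutoff, a test
  function of the transform at \<omega> = \<i> n, which lies in the open upper half-plane.\<close>

definition exp_sum :: "(nat \<Rightarrow> complex) \<Rightarrow> nat \<Rightarrow> real \<Rightarrow> complex" where
  "exp_sum a M t = (\<Sum>n\<in>{1..M}. a n * exp (- of_nat n * of_real t))"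

lemma
  shows smooth_fun_exp_sum: "smooth_fun (exp_sum a M)"
    and nth_vderiv_exp_sum: "nth_vderiv j (exp_sum a M) = exp_sum (\<lambda>n. (- of_nat n) ^ j * a n) M"
proof -
  let ?h = "\<lambda>j. exp_sum (\<lambda>n. (- of_nat n) ^ j * a n) M"
  have *: "(?h j has_vector_derivative ?h (Suc j) t) (at t)" for j t
    unfolding exp_sum_def[abs_def]
  proof (rule has_vector_derivative_sum)
    fix n
    have "((\<lambda>t. (- of_nat n) ^ j * a n * exp (- of_nat n * complex_of_real t)) has_vector_derivative
      (- of_nat n) ^ j * a n * (- of_nat n * exp (- of_nat n * complex_of_real t))) (at t)"
      using has_vderiv_nth_vderiv[OF smooth_fun_exp[of "- of_nat n"], of 0 t, unfolded nth_vderiv_exp]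
      by (intro has_vector_derivative_mult_right) simp
    then show "((\<lambda>t. (- of_nat n) ^ j * a n * exp (- of_nat n * complex_of_real t)) has_vector_derivative
      (- of_nat n) ^ Suc j * a n * exp (- of_nat n * complex_of_real t)) (at t)"
      by (simp only: power_Suc mult_ac)
  qed
  show "smooth_fun (exp_sum a M)" using smooth_funI[of ?h, OF *] by simp
  show "nth_vderiv j (exp_sum a M) = ?h j" using nth_vderiv_eqI[of ?h, OF *] by simp
qed

lemma exp_sum_tendsto_0: "(exp_sum a M \<longlongrightarrow> 0) at_top"
proof -
  have "((\<lambda>t. \<Sum>n\<in>{1..M}. a n * exp (- of_nat n * complex_of_real t)) \<longlongrightarrow> (\<Sum>n\<in>{1..M}. a n * 0)) at_top"
  proof (intro tendsto_sum tendsto_mult tendsto_const)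
    fix n assume "n \<in> {1..M}"
    then have "filterlim (\<lambda>t. real n * t) at_top at_top"
      by (intro filterlim_tendsto_pos_mult_at_top[OF tendsto_const _ filterlim_ident]) simp
    then have "((\<lambda>t. exp (- (real n * t))) \<longlongrightarrow> 0) at_top"
      by (intro filterlim_compose[OF exp_at_bot] filterlim_compose[OF filterlim_uminus_at_bot_at_top])
    then show "((\<lambda>t. exp (- of_nat n * complex_of_real t)) \<longlongrightarrow> 0) at_top"
      by (rule tendsto_norm_zero_cancel[OF Lim_transform_eventually]) simp
  qed
  then show ?thesis by (simp add: exp_sum_def[abs_def])
qed

text \<open>Real and imaginary part are approximated to within \<epsilon>/2 each, as the modulus is
  at most the sum of theirs; zero coefficients pad both polynomials to a common degree.\<close>

lemma complex_Weierstrass: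
  fixes c :: "real \<Rightarrow> complex"
  assumes "compact S" "continuous_on S c" "\<epsilon> > 0"
  obtains a :: "nat \<Rightarrow> complex" and M where "\<And>x. x \<in> S \<Longrightarrow> norm (c x - (\<Sum>i\<le>M. a i * of_real x ^ i)) \<le> \<epsilon>"
proof -
  have *: "\<exists>a M. \<forall>x\<in>S. \<bar>f x - (\<Sum>i\<le>M. a i * x ^ i)\<bar> < \<epsilon> / 2" if "continuous_on S f" for f :: "real \<Rightarrow> real"
    using Stone_Weierstrass_real_polynomial_function[OF assms(1) that, of "\<epsilon> / 2"] assms(3)
    unfolding real_polynomial_function_iff_sum by (metis half_gt_zero)
  obtain a M where a: "\<And>x. x \<in> S \<Longrightarrow> \<bar>Re (c x) - (\<Sum>i\<le>M. a i * x ^ i)\<bar> < \<epsilon> / 2"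
    using *[OF continuous_on_Re[OF assms(2)]] by blast
  obtain b N where b: "\<And>x. x \<in> S \<Longrightarrow> \<bar>Im (c x) - (\<Sum>i\<le>N. b i * x ^ i)\<bar> < \<epsilon> / 2"
    using *[OF continuous_on_Im[OF assms(2)]] by blast
  define a' where "a' i = (if i \<le> M then a i else 0)" for i
  define b' where "b' i = (if i \<le> N then b i else 0)" for i
  have a': "(\<Sum>i\<le>max M N. a' i * x ^ i) = (\<Sum>i\<le>M. a i * x ^ i)" for x
    by (rule sum.mono_neutral_cong_right) (auto simp: a'_def)
  have b': "(\<Sum>i\<le>max M N. b' i * x ^ i) = (\<Sum>i\<le>N. b i * x ^ i)" for x
    by (rule sum.mono_neutral_cong_right) (auto simp: b'_def)
  show thesis
  proof (rule that[of "\<lambda>i. Complex (a' i) (b' i)" "max M N"])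
    fix x assume x: "x \<in> S"
    let ?d = "c x - (\<Sum>i\<le>max M N. Complex (a' i) (b' i) * complex_of_real x ^ i)"
    have "Re ?d = Re (c x) - (\<Sum>i\<le>M. a i * x ^ i)" "Im ?d = Im (c x) - (\<Sum>i\<le>N. b i * x ^ i)"
      by (simp_all flip: a' b' of_real_power)
    then show "norm ?d \<le> \<epsilon>" using cmod_le[of ?d] a[OF x] b[OF x] by linarith
  qed
qed

lemma schwartz_nth_vderiv:
  assumes "\<psi> \<in> schwartz_space"
  shows "nth_vderiv n \<psi> \<in> schwartz_space"
  by (rule schwartzI)
    (use schwartz_seminorm_ge[OF assms] in \<open>auto simp: smooth_fun_nth_vderiv[OF schwartz_smooth[OF assms]]\<close>)

text \<open>One extra power is spent: the seminorms bound (1 + t)^(K + 1) \<psi>(t) by B, and (2 +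
  t)^K \<le> 2^K (1 + t)^K. The weighted value is thus at most 2^K B / (1 + t), which explains the
  threshold.\<close>

lemma schwartz_weighted_tail:
  assumes "\<psi> \<in> schwartz_space" "\<epsilon> > 0"
  obtains T where "T \<ge> 0" "\<And>t. t \<ge> T \<Longrightarrow> norm (\<psi> t) * (2 + t) ^ K \<le> \<epsilon>"
proof -
  define B where "B = 2 ^ Suc K * (schwartz_seminorm 0 0 \<psi> + schwartz_seminorm (Suc K) 0 \<psi>)"
  have B0: "B \<ge> 0" unfolding B_def using schwartz_seminorm_nonneg[OF assms(1)] by simp
  have B: "(1 + \<bar>t\<bar>) ^ Suc K * norm (\<psi> t) \<le> B" for t
    using schwartz_weight_le[OF assms(1), of t "Suc K" 0] by (simp add: B_def)
  show thesis
  proof (rule that[of "2 ^ K * B / \<epsilon>"])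
    show "2 ^ K * B / \<epsilon> \<ge> 0" using B0 assms by simp
    fix t assume t: "t \<ge> 2 ^ K * B / \<epsilon>"
    have t0: "t \<ge> 0" using t B0 assms(2) by (meson divide_nonneg_pos mult_nonneg_nonneg order_trans zero_le_numeral zero_le_power)
    have "(2 + t) ^ K \<le> (2 * (1 + t)) ^ K" using t0 by (intro power_mono) auto
    then have "norm (\<psi> t) * (2 + t) ^ K \<le> norm (\<psi> t) * (2 ^ K * (1 + t) ^ K)"
      unfolding power_mult_distrib by (intro mult_left_mono) auto
    moreover have "(1 + t) * (norm (\<psi> t) * (2 ^ K * (1 + t) ^ K)) \<le> 2 ^ K * B"
      using mult_left_mono[OF B[of t], of "2 ^ K"] t0 by (simp add: mult_ac)
    moreover have "2 ^ K * B \<le> (1 + t) * \<epsilon>"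
      using t assms(2) t0 by (simp add: pos_divide_le_eq distrib_right)
    ultimately have "(1 + t) * (norm (\<psi> t) * (2 + t) ^ K) \<le> (1 + t) * \<epsilon>"
      using mult_left_mono[of "norm (\<psi> t) * (2 + t) ^ K" "norm (\<psi> t) * (2 ^ K * (1 + t) ^ K)" "1 + t"] t0 by linarith
    then show "norm (\<psi> t) * (2 + t) ^ K \<le> \<epsilon>" using t0 by simp
  qed
qed

lemma schwartz_tendsto_0:
  assumes "\<psi> \<in> schwartz_space"
  shows "(\<psi> \<longlongrightarrow> 0) at_top"
proof (rule tendstoI)
  fix e :: real assume "e > 0"
  then obtain T where "\<And>t. t \<ge> T \<Longrightarrow> norm (\<psi> t) * (2 + t) ^ 0 \<le> e / 2"
    using schwartz_weighted_tail[OF assms, of "e / 2" 0] by (metis half_gt_zero)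
  then show "\<forall>\<^sub>F t in at_top. dist (\<psi> t) 0 < e"
    using \<open>e > 0\<close> unfolding eventually_at_top_linorder by (intro exI[of _ T]) force
qed

text \<open>In the variable \<open>x = exp (- t)\<close> the exponential sums are polynomials without constant term.
  The factor \<open>min 1 (R x)\<close> cuts \<open>\<psi>\<close> off at \<open>t = \<infinity>\<close>, so that division by \<open>x\<close> leaves a continuous
  function on \<open>{0..e}\<close>.\<close>

lemma exp_sum_approx_0:
  assumes \<psi>: "\<psi> \<in> schwartz_space" and "\<epsilon> > 0"
  obtains a M where "\<And>t. t \<ge> -1 \<Longrightarrow> norm (\<psi> t - exp_sum a M t) \<le> \<epsilon> / (2 + t) ^ K"
proof -
  obtain T where T: "T \<ge> 0" "\<And>t. t \<ge> T \<Longrightarrow> norm (\<psi> t) * (2 + t) ^ K \<le> \<epsilon> / 2"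
    using schwartz_weighted_tail[OF \<psi>, of "\<epsilon> / 2" K] assms(2) by (metis half_gt_zero)
  obtain B0 where "\<forall>t::real\<ge>-1. (1 + \<bar>t\<bar>) ^ K * exp (- 1 * t) \<le> B0"
    using power_exp_bounded[OF zero_less_one, of "-1" K] by blast
  then have B0: "(1 + \<bar>t\<bar>) ^ K * exp (- t) \<le> B0" if "t \<ge> -1" for t using that by simp
  \<comment> \<open>B dominates (2 + t)^K exp (-t). A polynomial error of \<epsilon> / (2 B) in x,
    multiplied by x = exp (-t), is then at most half of the admissible weighted error.\<close>
  define B where "B = 2 ^ K * B0"
  have B: "(2 + t) ^ K * exp (- t) \<le> B" if "t \<ge> -1" for t
  proof -
    have "(2 + t) ^ K \<le> (2 * (1 + \<bar>t\<bar>)) ^ K" using that by (intro power_mono) auto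
    then have "(2 + t) ^ K * exp (- t) \<le> 2 ^ K * ((1 + \<bar>t\<bar>) ^ K * exp (- t))"
      unfolding power_mult_distrib mult.assoc[symmetric] by (intro mult_right_mono) auto
    also have "\<dots> \<le> B" unfolding B_def using B0[OF that] by (intro mult_left_mono) auto
    finally show ?thesis .
  qed
  have "B > 0" by (rule less_le_trans[OF _ B[of 0]]) auto
  \<comment> \<open>With this R the factor \<open>min 1 (R * x)\<close> equals 1 exactly for t \<le>
    T, so \<psi> is altered only on the tail where it is already small.\<close>
  define R where "R = exp T"
  define c where "c x = (if x = 0 then 0 else \<psi> (- ln x) * of_real (min (1 / x) R))" for x :: real
  have "continuous_on {0..exp 1} c"
    unfolding continuous_on_eq_continuous_within
  proof
    fix x :: real assume x: "x \<in> {0..exp 1}"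
    show "continuous (at x within {0..exp 1}) c"
    proof (cases "x = 0")
      case True
      have "((\<lambda>x. \<psi> (- ln x)) \<longlongrightarrow> 0) (at_right 0)"
        by (rule filterlim_compose[OF schwartz_tendsto_0[OF \<psi>]])
          (intro filterlim_compose[OF filterlim_uminus_at_top_at_bot] ln_at_0)
      then have lim: "((\<lambda>x. norm (\<psi> (- ln x)) * R) \<longlongrightarrow> 0 * R) (at_right 0)"
        by (intro tendsto_mult tendsto_const tendsto_norm_zero)
      have "(c \<longlongrightarrow> 0) (at_right 0)"
      proof (rule Lim_null_comparison)
        show "\<forall>\<^sub>F x in at_right 0. norm (c x) \<le> norm (\<psi> (- ln x)) * R"
          unfolding eventually_at_filter
        proof (rule always_eventually, intro allI impI)
          fix x :: real assume "x \<noteq> 0" "x \<in> {0<..}"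
          then have "x > 0" by simp
          have "\<bar>min (1 / x) R\<bar> \<le> R"
            using \<open>x > 0\<close> unfolding R_def by (simp add: abs_of_nonneg)
          then show "norm (c x) \<le> norm (\<psi> (- ln x)) * R"
            by (auto simp: c_def norm_mult simp del: of_real_divide intro!: mult_left_mono)
        qed
      qed (use lim in simp)
      then show ?thesis using True
        by (simp add: continuous_within at_within_Icc_at_right c_def)
    next
      case False
      then have x0: "x > 0" using x by simp
      have "isCont \<psi> (- ln x)"
        using has_vector_derivative_continuous[OF has_vderiv_nth_vderiv[OF schwartz_smooth[OF \<psi>], of 0]] by simp
      moreover have "isCont (\<lambda>x. - ln x) x" using x0 by (intro continuous_intros) auto
      ultimately have "isCont (\<lambda>x. \<psi> (- ln x)) x" by (rule isCont_o2[rotated])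
      moreover have "isCont (\<lambda>x. complex_of_real (min (1 / x) R)) x"
        using x0 by (intro continuous_intros) auto
      ultimately have "isCont (\<lambda>x. \<psi> (- ln x) * of_real (min (1 / x) R)) x"
        by (rule continuous_mult)
      moreover have "\<forall>\<^sub>F y in nhds x. y \<in> {0<..}"
        using x0 by (intro eventually_nhds_in_open) auto
      then have "\<forall>\<^sub>F y in nhds x. \<psi> (- ln y) * of_real (min (1 / y) R) = c y"
        by eventually_elim (auto simp: c_def)
      ultimately have "isCont c x" using isCont_cong by fast
      then show ?thesis by (rule continuous_at_imp_continuous_at_within)
    qed
  qed
  moreover have "\<epsilon> / (2 * B) > 0" using assms \<open>B > 0\<close> by simp
  ultimately obtain a M where a: "\<And>x. x \<in> {0..exp 1} \<Longrightarrow> norm (c x - (\<Sum>i\<le>M. a i * of_real x ^ i)) \<le> \<epsilon> / (2 * B)"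
    using complex_Weierstrass[of "{0..exp 1}" c "\<epsilon> / (2 * B)"] by (metis compact_Icc)
  show thesis
  \<comment> \<open>The polynomial approximates the quotient by x; multiplying back by x shifts each
    exponent by one and removes the constant term.\<close>
  proof (rule that[of "\<lambda>n. a (n - 1)" "Suc M"])
    fix t :: real assume t: "t \<ge> -1"
    define x where "x = exp (- t)"
    have x: "x > 0" "x \<le> exp 1" "ln x = - t" using t by (auto simp: x_def)
    have w: "(2 + t) ^ K > 0" using t by simp
    have "exp_sum (\<lambda>n. a (n - 1)) (Suc M) t = (\<Sum>i\<le>M. a i * of_real x ^ Suc i)"
    proof -
      have "exp_sum (\<lambda>n. a (n - 1)) (Suc M) t = (\<Sum>i\<le>M. a i * exp (- of_nat (Suc i) * complex_of_real t))"
        unfolding exp_sum_def by (rule sum.reindex_bij_witness[of _ Suc "\<lambda>n. n - 1"]) auto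
      moreover have "exp (- of_nat n * complex_of_real t) = of_real x ^ n" for n
        by (simp add: x_def exp_of_nat_mult[symmetric] flip: exp_of_real)
      ultimately show ?thesis by (simp only:)
    qed
    then have "of_real x * c x - exp_sum (\<lambda>n. a (n - 1)) (Suc M) t = of_real x * (c x - (\<Sum>i\<le>M. a i * of_real x ^ i))"
      by (simp add: sum_distrib_left right_diff_distrib mult_ac)
    then have "norm (of_real x * c x - exp_sum (\<lambda>n. a (n - 1)) (Suc M) t) \<le> x * (\<epsilon> / (2 * B))"
      using mult_left_mono[OF a[of x], of x] x by (simp add: norm_mult)
    also have "\<dots> \<le> (\<epsilon> / 2) / (2 + t) ^ K"
    proof -
      have "x * (2 + t) ^ K \<le> B" using B[OF t] by (simp add: x_def mult.commute)
      then have "x \<le> B / (2 + t) ^ K" using w by (simp add: pos_le_divide_eq)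
      then have "x * (\<epsilon> / (2 * B)) \<le> B / (2 + t) ^ K * (\<epsilon> / (2 * B))"
        using assms \<open>B > 0\<close> by (intro mult_right_mono) auto
      then show ?thesis using \<open>B > 0\<close> by simp
    qed
    finally have 1: "norm (of_real x * c x - exp_sum (\<lambda>n. a (n - 1)) (Suc M) t) \<le> (\<epsilon> / 2) / (2 + t) ^ K" .
    have 2: "norm (\<psi> t - of_real x * c x) \<le> (\<epsilon> / 2) / (2 + t) ^ K"
    proof -
      have c: "of_real x * c x = of_real (min 1 (R * x)) * \<psi> t"
      proof -
        have "x * min (1 / x) R = min 1 (R * x)" using x by (simp add: min_def field_simps)
        then have "of_real x * complex_of_real (min (1 / x) R) = of_real (min 1 (R * x))"
          by (metis of_real_mult)
        then show ?thesis using x by (simp add: c_def mult_ac)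
      qed
      show ?thesis
      proof (cases "t \<le> T")
        case True
        then have "R * x \<ge> 1" by (simp add: R_def x_def flip: exp_add)
        then have "\<psi> t - of_real x * c x = 0" unfolding c by (simp add: min_def)
        then show ?thesis using assms w by simp
      next
        case False
        have "\<psi> t - of_real x * c x = of_real (1 - min 1 (R * x)) * \<psi> t"
          unfolding c by (simp add: algebra_simps)
        then have "norm (\<psi> t - of_real x * c x) = \<bar>1 - min 1 (R * x)\<bar> * norm (\<psi> t)"
          by (simp only: norm_mult norm_of_real)
        also have "\<dots> \<le> 1 * norm (\<psi> t)"
          using x by (intro mult_right_mono) (auto simp: R_def min_def)
        finally have "norm (\<psi> t - of_real x * c x) \<le> norm (\<psi> t)" by simp
        moreover have "norm (\<psi> t) \<le> (\<epsilon> / 2) / (2 + t) ^ K"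
          using T(2)[of t] False w by (simp add: pos_le_divide_eq)
        ultimately show ?thesis by linarith
      qed
    qed
    have "\<psi> t - exp_sum (\<lambda>n. a (n - 1)) (Suc M) t
        = (\<psi> t - of_real x * c x) + (of_real x * c x - exp_sum (\<lambda>n. a (n - 1)) (Suc M) t)" by simp
    also have "norm \<dots> \<le> (\<epsilon> / 2) / (2 + t) ^ K + (\<epsilon> / 2) / (2 + t) ^ K"
      using 1 2 norm_triangle_mono by blast
    finally show "norm (\<psi> t - exp_sum (\<lambda>n. a (n - 1)) (Suc M) t) \<le> \<epsilon> / (2 + t) ^ K"
      by (simp add: add_divide_distrib[symmetric])
  qed
qed

text \<open>The mean value inequality on [t, T] against a primitive of \<epsilon> / (2 + s)^(K + 2),
  followed by T -> \<infinity>. Integration costs one power of 2 + t; the second is given away,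
  since 2 + t \<ge> 1, and keeps the exponent integrable at infinity even for K = 0.\<close>

lemma vanishing_at_top_bound:
  fixes d :: "real \<Rightarrow> complex"
  assumes d: "\<And>t. (d has_vector_derivative d' t) (at t)" "(d \<longlongrightarrow> 0) at_top"
    and b: "\<And>t. t \<ge> -1 \<Longrightarrow> norm (d' t) \<le> \<epsilon> / (2 + t) ^ Suc (Suc K)" and "\<epsilon> > 0" "t \<ge> -1"
  shows "norm (d t) \<le> \<epsilon> / (2 + t) ^ K"
proof -
  define \<phi> where "\<phi> s = - \<epsilon> / (real (Suc K) * (2 + s) ^ Suc K)" for s
  have \<phi>: "(\<phi> has_real_derivative \<epsilon> / (2 + s) ^ Suc (Suc K)) (at s)" if "s \<ge> -1" for s
  proof -
    have "((\<lambda>s. (- \<epsilon> / real (Suc K)) * inverse ((2 + s) ^ Suc K)) has_real_derivative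
       (- \<epsilon> / real (Suc K)) * - (inverse ((2 + s) ^ Suc K) * (real (Suc K) * (2 + s) ^ K) * inverse ((2 + s) ^ Suc K))) (at s)"
      using that by (auto intro!: derivative_eq_intros simp del: power_Suc of_nat_Suc)
    moreover have "(- \<epsilon> / real (Suc K)) * - (inverse ((2 + s) ^ Suc K) * (real (Suc K) * (2 + s) ^ K) * inverse ((2 + s) ^ Suc K))
        = \<epsilon> / (2 + s) ^ Suc (Suc K)"
    proof -
      have "(- \<epsilon> / n) * - (inverse (w * y) * (n * y) * inverse (w * y)) = \<epsilon> / (w * (w * y))"
        if "n \<noteq> 0" "w \<noteq> 0" "y \<noteq> 0" for n w y
        using that by (simp add: field_simps)
      from this[of "real (Suc K)" "2 + s" "(2 + s) ^ K"] that show ?thesis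
        by (simp del: of_nat_Suc)
    qed
    moreover have "(\<lambda>s. (- \<epsilon> / real (Suc K)) * inverse ((2 + s) ^ Suc K)) = \<phi>"
      by (auto simp: \<phi>_def field_simps)
    ultimately show ?thesis by metis
  qed
  have "\<forall>\<^sub>F T in at_top. norm (d T - d t) \<le> \<epsilon> / (2 + t) ^ K"
    using eventually_gt_at_top[of t]
  proof eventually_elim
    case (elim T)
    have "norm (d T - d t) \<le> \<phi> T - \<phi> t"
    proof (rule differentiable_bound_general[OF elim])
      show "continuous_on {t..T} d"
        using d(1) by (meson continuous_at_imp_continuous_on has_vector_derivative_continuous)
      show "continuous_on {t..T} \<phi>"
        using assms(5) by (intro continuous_at_imp_continuous_on ballI DERIV_isCont[OF \<phi>]) auto
      show "(d has_vector_derivative d' s) (at s)" for s by (rule d)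
      show "(\<phi> has_vector_derivative \<epsilon> / (2 + s) ^ Suc (Suc K)) (at s)" if "t < s" for s
        using \<phi>[of s] that assms(5) by (simp add: has_real_derivative_iff_has_vector_derivative)
      show "norm (d' s) \<le> \<epsilon> / (2 + s) ^ Suc (Suc K)" if "t < s" for s
        using b[of s] that assms(5) by simp
    qed
    also have "\<phi> T \<le> 0" using elim assms(4,5) by (simp add: \<phi>_def)
    also have "0 - \<phi> t \<le> \<epsilon> / (2 + t) ^ K"
    proof -
      have "1 * (2 + t) ^ K \<le> (real (Suc K) * (2 + t)) * (2 + t) ^ K"
      proof (rule mult_right_mono)
        have "1 * 1 \<le> real (Suc K) * (2 + t)" using assms(5) by (intro mult_mono) auto
        then show "1 \<le> real (Suc K) * (2 + t)" by simp
      qed (use assms(5) in auto)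
      then have "\<epsilon> / ((real (Suc K) * (2 + t)) * (2 + t) ^ K) \<le> \<epsilon> / (1 * (2 + t) ^ K)"
        using assms(4,5) by (intro divide_left_mono mult_pos_pos) auto
      then show ?thesis by (simp add: \<phi>_def mult.assoc del: of_nat_Suc)
    qed
    finally show ?case by simp
  qed
  moreover have "((\<lambda>T. norm (d T - d t)) \<longlongrightarrow> norm (0 - d t)) at_top"
    by (intro tendsto_intros d)
  ultimately have "norm (0 - d t) \<le> \<epsilon> / (2 + t) ^ K"
    by (intro tendsto_upperbound) auto
  then show ?thesis by simp
qed

text \<open>Induction on N with \<psi> and K free: the hypothesis is applied to the derivative of
  \<psi> with exponent K + 2, so the two powers lost by each integration are paid in
  advance.\<close>

lemma exp_sum_approx:
  assumes "\<psi> \<in> schwartz_space" and "\<epsilon> > 0"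
  shows "\<exists>a M. \<forall>j\<le>N. \<forall>t\<ge>-1. norm (nth_vderiv j \<psi> t - nth_vderiv j (exp_sum a M) t) \<le> \<epsilon> / (2 + t) ^ K"
  using assms(1)
proof (induction N arbitrary: \<psi> K)
  case 0
  obtain a M where "\<And>t. t \<ge> -1 \<Longrightarrow> norm (\<psi> t - exp_sum a M t) \<le> \<epsilon> / (2 + t) ^ K"
    using exp_sum_approx_0[OF 0 assms(2), of K] by blast
  then show ?case by auto
next
  case (Suc N)
  note smooth = schwartz_smooth[OF Suc.prems]
  from Suc.IH[OF schwartz_nth_vderiv[OF Suc.prems, of 1], of "Suc (Suc K)"] obtain a M where
    a: "\<And>j t. j \<le> N \<Longrightarrow> t \<ge> -1 \<Longrightarrow>
      norm (nth_vderiv (Suc j) \<psi> t - nth_vderiv j (exp_sum a M) t) \<le> \<epsilon> / (2 + t) ^ Suc (Suc K)"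
    by (auto simp: smooth_fun_nth_vderiv[OF smooth] simp del: power_Suc)
  \<comment> \<open>The coefficients of the termwise antiderivative that vanishes at infinity; the
    division is harmless because the sums start at n = 1.\<close>
  define b where "b n = - a n / of_nat n" for n
  have ba: "nth_vderiv (Suc j) (exp_sum b M) = nth_vderiv j (exp_sum a M)" for j
    unfolding nth_vderiv_exp_sum by (auto simp: exp_sum_def b_def intro!: sum.cong)
  have "norm (nth_vderiv j \<psi> t - nth_vderiv j (exp_sum b M) t) \<le> \<epsilon> / (2 + t) ^ K" if "j \<le> Suc N" "t \<ge> -1" for j t
  proof (cases j)
    case 0
    have "norm (\<psi> t - exp_sum b M t) \<le> \<epsilon> / (2 + t) ^ K"
    proof (rule vanishing_at_top_bound[where d' = "\<lambda>t. nth_vderiv 1 \<psi> t - exp_sum a M t"])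
      fix t
      show "((\<lambda>t. \<psi> t - exp_sum b M t) has_vector_derivative nth_vderiv 1 \<psi> t - exp_sum a M t) (at t)"
        using has_vderiv_nth_vderiv[OF smooth, of 0 t] has_vderiv_nth_vderiv[OF smooth_fun_exp_sum[of b M], of 0 t] ba[of 0]
        by (intro has_vector_derivative_diff) auto
      show "norm (nth_vderiv 1 \<psi> t - exp_sum a M t) \<le> \<epsilon> / (2 + t) ^ Suc (Suc K)" if "t \<ge> -1"
        using a[of 0 t] that by simp
    next
      show "((\<lambda>t. \<psi> t - exp_sum b M t) \<longlongrightarrow> 0) at_top"
        using tendsto_diff[OF schwartz_tendsto_0[OF Suc.prems] exp_sum_tendsto_0[of b M]] by simp
    qed (use assms that in auto)
    then show ?thesis using 0 by simp
  next
    case (Suc i)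
    then have "norm (nth_vderiv j \<psi> t - nth_vderiv j (exp_sum b M) t) \<le> \<epsilon> / (2 + t) ^ Suc (Suc K)"
      using a[of i t] that by (simp only: ba Suc)
    also have "\<dots> \<le> \<epsilon> / (2 + t) ^ K"
      using that assms(2) by (intro divide_left_mono power_increasing mult_pos_pos) auto
    finally show ?thesis .
  qed
  then show ?case by blast
qed

section \<open>Injectivity of the Fourier--Laplace transform\<close>

lemma exp_sum_Suc: "exp_sum a (Suc M) t = exp_sum a M t + a (Suc M) * exp (- of_nat (Suc M) * of_real t)"
  by (simp add: exp_sum_def del: of_nat_Suc)

lemma cutoff_exp_sum:
  assumes u: "tempered_distribution u" and \<kappa>: "half_line_cutoff \<kappa>"
    and zero: "\<And>n. n > 0 \<Longrightarrow> u (\<lambda>t. \<kappa> t * exp (\<i> * (\<i> * of_nat n) * of_real t)) = 0"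
  shows "(\<lambda>t. \<kappa> t * exp_sum a M t) \<in> schwartz_space \<and> u (\<lambda>t. \<kappa> t * exp_sum a M t) = 0"
proof (induction M)
  case 0
  \<comment> \<open>The empty sum is 0, realised as 0 times a Schwartz function so that homogeneity
    of u applies; here \<omega> = \<i>.\<close>
  have e: "(\<lambda>t. \<kappa> t * exp (\<i> * \<i> * of_real t)) \<in> schwartz_space"
    by (rule cutoff_exp_schwartz[OF \<kappa>]) simp
  show ?case
    using schwartz_cmult[OF e, of 0] tempered_cmult[OF u e, of 0] by (simp add: exp_sum_def)
next
  case (Suc M)
  define E where "E t = \<kappa> t * exp (\<i> * (\<i> * of_nat (Suc M)) * of_real t)" for t
  have E: "E \<in> schwartz_space" "u E = 0"
    unfolding E_def[abs_def] by (rule cutoff_exp_schwartz[OF \<kappa>] zero; simp)+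
  have eq: "(\<lambda>t. \<kappa> t * exp_sum a (Suc M) t) = (\<lambda>t. \<kappa> t * exp_sum a M t + a (Suc M) * E t)"
  proof
    fix t
    have "\<i> * (\<i> * of_nat (Suc M)) * of_real t = - of_nat (Suc M) * complex_of_real t"
      by (simp only: mult.assoc[symmetric] i_squared power2_eq_square[symmetric]) simp
    then show "\<kappa> t * exp_sum a (Suc M) t = \<kappa> t * exp_sum a M t + a (Suc M) * E t"
      by (simp only: E_def exp_sum_Suc distrib_left mult_ac)
  qed
  show ?case unfolding eq
    using Suc schwartz_cmult[OF E(1)]
    by (simp add: schwartz_add tempered_add[OF u] tempered_cmult[OF u E(1)] E(2))
qed

lemma le_of_forall_mult_le:
  fixes x C :: real
  assumes "\<And>e. e > 0 \<Longrightarrow> x \<le> C * e"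
  shows "x \<le> 0"
proof (rule ccontr)
  assume "\<not> x \<le> 0"
  define e where "e = x / (2 * (\<bar>C\<bar> + 1))"
  have "e > 0" using \<open>\<not> x \<le> 0\<close> by (simp add: e_def)
  then have "x \<le> C * e" by (rule assms)
  also have "\<dots> \<le> (\<bar>C\<bar> + 1) * e" using \<open>e > 0\<close> by (intro mult_right_mono) auto
  also have "\<dots> = x / 2" by (simp add: e_def field_simps)
  finally show False using \<open>\<not> x \<le> 0\<close> by simp
qed

text \<open>Since u annihilates \<kappa> times every exponential sum, \<psi> may be replaced by its
  approximation error r. Continuity of finite order N then asks only for smallness of the
  derivatives of \<kappa> r up to N, with weights up to N.\<close>

lemma tempered_eq_0_of_cutoff:
  assumes u: "tempered_distribution u" and \<kappa>: "half_line_cutoff \<kappa>" "\<And>t. t < -1 \<Longrightarrow> \<kappa> t = 0"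
    and zero: "\<And>n. n > 0 \<Longrightarrow> u (\<lambda>t. \<kappa> t * exp (\<i> * (\<i> * of_nat n) * of_real t)) = 0"
    and \<psi>: "\<psi> \<in> schwartz_space"
  shows "u (\<lambda>t. \<kappa> t * \<psi> t) = 0"
proof -
  note \<kappa>s = \<kappa>(1)[unfolded half_line_cutoff_def, THEN conjunct1]
  from u obtain C N where CN: "C \<ge> 0" "\<And>\<psi> e. \<psi> \<in> schwartz_space \<Longrightarrow>
     (\<And>k j t. k \<le> N \<Longrightarrow> j \<le> N \<Longrightarrow> \<bar>t\<bar> ^ k * norm (nth_vderiv j \<psi> t) \<le> e) \<Longrightarrow> norm (u \<psi>) \<le> C * e"
    using tempered_small by blast
  obtain A where A: "A \<ge> 0" "\<And>i t. i \<le> N \<Longrightarrow> norm (nth_vderiv i \<kappa> t) \<le> A"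
    using bounded_upto[of "\<lambda>i t. norm (nth_vderiv i \<kappa> t)" N] half_line_cutoff_bounded[OF \<kappa>(1)] by metis
  have \<kappa>\<psi>: "(\<lambda>t. \<kappa> t * \<psi> t) \<in> schwartz_space"
    by (rule schwartz_smooth_mult[OF \<kappa>s half_line_cutoff_bounded[OF \<kappa>(1)] \<psi>])
  have "norm (u (\<lambda>t. \<kappa> t * \<psi> t)) \<le> (C * (2 ^ N * A)) * \<epsilon>" if \<epsilon>: "\<epsilon> > 0" for \<epsilon>
  proof -
    obtain a M where aM: "\<And>j t. j \<le> N \<Longrightarrow> t \<ge> -1 \<Longrightarrow>
        norm (nth_vderiv j \<psi> t - nth_vderiv j (exp_sum a M) t) \<le> \<epsilon> / (2 + t) ^ N"
      using exp_sum_approx[OF \<psi> \<epsilon>, of N N] by blast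
    define r where "r t = \<psi> t + (-1) * exp_sum a M t" for t
    have r: "smooth_fun r" "\<And>j. nth_vderiv j r = (\<lambda>t. nth_vderiv j \<psi> t - nth_vderiv j (exp_sum a M) t)"
      unfolding r_def
      using smooth_fun_add[OF schwartz_smooth[OF \<psi>] smooth_fun_cmult[OF smooth_fun_exp_sum, of "-1"]]
        nth_vderiv_add[OF schwartz_smooth[OF \<psi>] smooth_fun_cmult[OF smooth_fun_exp_sum, of "-1"]]
      unfolding nth_vderiv_cmult[OF smooth_fun_exp_sum] by auto
    note Q = cutoff_exp_sum[OF u \<kappa>(1) zero, of a M]
    have \<kappa>r: "(\<lambda>t. \<kappa> t * r t) = (\<lambda>t. \<kappa> t * \<psi> t - \<kappa> t * exp_sum a M t)"
      by (auto simp: r_def algebra_simps)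
    have "norm (u (\<lambda>t. \<kappa> t * r t)) \<le> C * (2 ^ N * A * \<epsilon>)"
    proof (rule CN(2))
      show "(\<lambda>t. \<kappa> t * r t) \<in> schwartz_space"
        unfolding \<kappa>r using schwartz_add[OF \<kappa>\<psi> schwartz_cmult[OF Q[THEN conjunct1], of "-1"]] by simp
      fix k j t assume kj: "k \<le> N" "j \<le> N"
      show "\<bar>t\<bar> ^ k * norm (nth_vderiv j (\<lambda>t. \<kappa> t * r t) t) \<le> 2 ^ N * A * \<epsilon>"
      proof (cases "t < -1")
        case True
        have "nth_vderiv j (\<lambda>t. \<kappa> t * r t) t = nth_vderiv j (\<lambda>t. 0) t"
          by (rule nth_vderiv_cong_open[of "{..<-1}"]) (use True \<kappa> in auto)
        then show ?thesis using A that by (simp add: nth_vderiv_const)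
      next
        case False
        have w: "(2 + t) ^ N > 0" using False by simp
        have "norm (nth_vderiv j (\<lambda>t. \<kappa> t * r t) t) \<le> 2 ^ j * A * (\<epsilon> / (2 + t) ^ N)"
          by (rule norm_nth_vderiv_mult_le[OF \<kappa>s r(1)]) (use A aM False kj in \<open>auto simp: r(2)\<close>)
        also have "\<dots> \<le> 2 ^ N * A * (\<epsilon> / (2 + t) ^ N)"
          using A \<epsilon> w kj by (intro mult_right_mono power_increasing) auto
        finally have "\<bar>t\<bar> ^ k * norm (nth_vderiv j (\<lambda>t. \<kappa> t * r t) t) \<le> (2 + t) ^ N * (2 ^ N * A * (\<epsilon> / (2 + t) ^ N))"
        proof (rule mult_mono[rotated])
          \<comment> \<open>On t \<ge> -1 one has \<bar>t\<bar> \<le> 2 + t and 1 \<le> 2 + t, so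
            the single weight (2 + t)^N serves all k \<le> N.\<close>
          have "\<bar>t\<bar> ^ k \<le> (2 + t) ^ k" using False by (intro power_mono) auto
          also have "\<dots> \<le> (2 + t) ^ N" using False kj by (intro power_increasing) auto
          finally show "\<bar>t\<bar> ^ k \<le> (2 + t) ^ N" .
        qed (use w in auto)
        also have "\<dots> = 2 ^ N * A * \<epsilon>" using False by auto
        finally show ?thesis .
      qed
    qed
    moreover have "u (\<lambda>t. \<kappa> t * r t) = u (\<lambda>t. \<kappa> t * \<psi> t)"
      unfolding \<kappa>r using tempered_diff[OF u \<kappa>\<psi> Q[THEN conjunct1]] Q by simp
    ultimately show ?thesis by (simp add: mult.assoc)
  qed
  from le_of_forall_mult_le[OF this] show ?thesis by simp
qed

text \<open>The support condition only speaks about compactly supported test functions, hence the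
  second cutoff, moved off to \<open>-\<infinity>\<close>.\<close>

lemma tempered_eq_0_left:
  assumes u: "tempered_distribution u" "supported_in u {0..}"
    and \<kappa>: "half_line_cutoff \<kappa>" "\<And>t. t < -1 \<Longrightarrow> \<kappa> t = 0" "\<And>t. t > -1/2 \<Longrightarrow> \<kappa> t = 1"
    and \<eta>: "\<eta> \<in> schwartz_space" "\<And>t. t > -1/2 \<Longrightarrow> \<eta> t = 0"
  shows "u \<eta> = 0"
proof -
  note \<kappa>s = \<kappa>(1)[unfolded half_line_cutoff_def, THEN conjunct1]
  from u(1) obtain C N where CN: "C \<ge> 0" "\<And>\<psi> e. \<psi> \<in> schwartz_space \<Longrightarrow>
     (\<And>k j t. k \<le> N \<Longrightarrow> j \<le> N \<Longrightarrow> \<bar>t\<bar> ^ k * norm (nth_vderiv j \<psi> t) \<le> e) \<Longrightarrow> norm (u \<psi>) \<le> C * e"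
    using tempered_small by blast
  obtain A where A: "A \<ge> 0" "\<And>i t. i \<le> N \<Longrightarrow> norm (nth_vderiv i \<kappa> t) \<le> A"
    using bounded_upto[of "\<lambda>i t. norm (nth_vderiv i \<kappa> t)" N] half_line_cutoff_bounded[OF \<kappa>(1)] by metis
  \<comment> \<open>One power more than continuity demands: the surplus factor 1 / \<bar>t\<bar> is
    what becomes small far to the left.\<close>
  define D where "D = (\<Sum>k\<le>N. \<Sum>i\<le>N. schwartz_seminorm (Suc k) i \<eta>)"
  have D: "\<bar>t\<bar> ^ Suc k * norm (nth_vderiv i \<eta> t) \<le> D" if "k \<le> N" "i \<le> N" for i k t
  proof -
    have "schwartz_seminorm (Suc k) i \<eta> \<le> (\<Sum>i\<le>N. schwartz_seminorm (Suc k) i \<eta>)"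
      by (rule member_le_sum) (use that schwartz_seminorm_nonneg[OF \<eta>(1)] in auto)
    also have "\<dots> \<le> D" unfolding D_def
      by (rule member_le_sum) (use that in \<open>auto intro!: sum_nonneg schwartz_seminorm_nonneg[OF \<eta>(1)]\<close>)
    finally show ?thesis using schwartz_seminorm_ge[OF \<eta>(1), of t "Suc k" i] by linarith
  qed
  have D0: "D \<ge> 0" using D[of 0 0 0] by simp
  have "norm (u \<eta>) \<le> (C * (2 ^ N * (1 + A) * D)) * e" if "e > 0" for e
  proof -
    define R where "R = 1 / e"
    have R: "R > 0" using that by (simp add: R_def)
    \<comment> \<open>\<xi> is 1 below -1 - R and 0 above -1/2 - R. Hence \<eta> - \<xi> \<eta>
      lives in [-1 - R, -1/2] and is annihilated, while on the region of \<xi> \<eta> the choice R =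
      1/e gives 1 / \<bar>t\<bar> \<le> e.\<close>
    define \<xi> where "\<xi> t = 1 + (-1) * \<kappa> (of_int 1 * t + R)" for t
    have 1: "smooth_fun \<xi>"
      unfolding \<xi>_def by (intro smooth_fun_add smooth_fun_const smooth_fun_cmult smooth_fun_affine \<kappa>s)
    have 2: "nth_vderiv j \<xi> t = (if j = 0 then 1 else 0) - nth_vderiv j \<kappa> (t + R)" for j t
      unfolding \<xi>_def[abs_def] nth_vderiv_add[OF smooth_fun_const smooth_fun_cmult[OF smooth_fun_affine[OF \<kappa>s]]]
        nth_vderiv_cmult[OF smooth_fun_affine[OF \<kappa>s]] nth_vderiv_affine[OF \<kappa>s] nth_vderiv_const
      by simp
    have \<xi>_le: "norm (nth_vderiv j \<xi> t) \<le> 1 + norm (nth_vderiv j \<kappa> (t + R))" for j t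
      unfolding 2 using norm_triangle_ineq4[of 1 "nth_vderiv j \<kappa> (t + R)"] by auto
    have 3: "\<exists>B. \<forall>t. norm (nth_vderiv j \<xi> t) \<le> B" for j
    proof -
      obtain B where "\<And>t. norm (nth_vderiv j \<kappa> t) \<le> B" using half_line_cutoff_bounded[OF \<kappa>(1)] by blast
      then show ?thesis using \<xi>_le[of j] by (meson add_left_mono order_trans)
    qed
    have S: "(\<lambda>t. \<xi> t * \<eta> t) \<in> schwartz_space" by (rule schwartz_smooth_mult[OF 1 3 \<eta>(1)])
    have "u (\<lambda>t. \<eta> t - \<xi> t * \<eta> t) = 0"
    proof (rule supported_in_eq_0[OF u(2)])
      show "smooth_fun (\<lambda>t. \<eta> t - \<xi> t * \<eta> t)"
        using schwartz_smooth[OF schwartz_add[OF \<eta>(1) schwartz_cmult[OF S, of "-1"]]] by simp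
      show "-1 - R \<le> t \<and> t \<le> -1/2" if "\<eta> t - \<xi> t * \<eta> t \<noteq> 0" for t
      proof (rule ccontr)
        assume "\<not> (-1 - R \<le> t \<and> t \<le> -1/2)"
        then consider "t + R < -1" | "t > -1/2" by linarith
        then show False using that \<kappa>(2)[of "t + R"] \<eta>(2)[of t] by cases (auto simp: \<xi>_def)
      qed
    qed simp
    then have "u \<eta> = u (\<lambda>t. \<xi> t * \<eta> t)" using tempered_diff[OF u(1) \<eta>(1) S] by simp
    also have "norm \<dots> \<le> C * (2 ^ N * (1 + A) * D * e)"
    proof (rule CN(2)[OF S])
      fix k j t assume kj: "k \<le> N" "j \<le> N"
      show "\<bar>t\<bar> ^ k * norm (nth_vderiv j (\<lambda>t. \<xi> t * \<eta> t) t) \<le> 2 ^ N * (1 + A) * D * e"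
      proof (cases "t > -R - 1/2")
        case True
        have "nth_vderiv j (\<lambda>t. \<xi> t * \<eta> t) t = nth_vderiv j (\<lambda>t. 0) t"
          by (rule nth_vderiv_cong_open[of "{-R - 1/2<..}"]) (use True \<kappa>(3) in \<open>auto simp: \<xi>_def\<close>)
        then show ?thesis using A D0 that by (simp add: nth_vderiv_const)
      next
        case False
        then have t: "\<bar>t\<bar> \<ge> R" "\<bar>t\<bar> > 0" using R by auto
        then have te: "1 / \<bar>t\<bar> \<le> e" using that by (simp add: R_def field_simps)
        have w: "\<bar>t\<bar> ^ Suc k > 0" using t(2) by (rule zero_less_power)
        have "norm (nth_vderiv j (\<lambda>t. \<xi> t * \<eta> t) t) \<le> 2 ^ j * (1 + A) * (D / \<bar>t\<bar> ^ Suc k)"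
        proof (rule norm_nth_vderiv_mult_le[OF 1 schwartz_smooth[OF \<eta>(1)]])
          fix i assume "i \<le> j"
          then have i: "i \<le> N" using kj by simp
          show "norm (nth_vderiv i \<xi> t) \<le> 1 + A" using \<xi>_le[of i t] A(2)[OF i, of "t + R"] by linarith
          show "norm (nth_vderiv i \<eta> t) \<le> D / \<bar>t\<bar> ^ Suc k"
            using D[OF kj(1) i, of t] unfolding pos_le_divide_eq[OF w] by (simp only: mult.commute)
        qed
        also have "\<dots> \<le> 2 ^ N * (1 + A) * (D / \<bar>t\<bar> ^ Suc k)"
          using A D0 kj by (intro mult_right_mono power_increasing) auto
        finally have "\<bar>t\<bar> ^ k * norm (nth_vderiv j (\<lambda>t. \<xi> t * \<eta> t) t)
            \<le> \<bar>t\<bar> ^ k * (2 ^ N * (1 + A) * (D / \<bar>t\<bar> ^ Suc k))" by (intro mult_left_mono) auto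
        also have "\<dots> = 2 ^ N * (1 + A) * D * (1 / \<bar>t\<bar>)" using t(2) by simp
        also have "\<dots> \<le> 2 ^ N * (1 + A) * D * e"
          using te A D0 by (intro mult_left_mono) auto
        finally show ?thesis .
      qed
    qed
    finally show ?thesis by (simp add: mult.assoc)
  qed
  from le_of_forall_mult_le[OF this] show ?thesis by simp
qed

text \<open>For the difference w, split \<psi> into \<kappa> \<psi> and (1 - \<kappa>) \<psi>: the
  values of the transform at \<i> n dispose of the first, the support condition of the
  second.\<close>

lemma fourier_laplace_inj:
  assumes u: "tempered_distribution u" "supported_in u {0..}"
    and v: "tempered_distribution v" "supported_in v {0..}"
    and eq: "\<And>\<omega>. Im \<omega> > 0 \<Longrightarrow> fourier_laplace u \<omega> = fourier_laplace v \<omega>"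
  shows "u = v"
proof -
  \<comment> \<open>Restricting the difference keeps it extensional, as
    \<open>tempered_distribution\<close> requires.\<close>
  define w where "w = (\<lambda>\<psi>\<in>schwartz_space. u \<psi> - v \<psi>)"
  have w: "tempered_distribution w" "supported_in w {0..}"
    unfolding w_def using tempered_distribution_diff[OF u(1) v(1)] supported_in_diff[OF u(2) v(2)] by auto
  obtain \<kappa> where \<kappa>: "half_line_cutoff \<kappa>" "\<And>t. t < -1 \<Longrightarrow> \<kappa> t = 0" "\<And>t. t > -1/2 \<Longrightarrow> \<kappa> t = 1"
    using cutoff_exists by blast
  note \<kappa>s = \<kappa>(1)[unfolded half_line_cutoff_def, THEN conjunct1]
  have zero: "w (\<lambda>t. \<kappa> t * exp (\<i> * (\<i> * of_nat n) * of_real t)) = 0" if "n > 0" for n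
  proof -
    have n: "Im (\<i> * of_nat n) > 0" using that by simp
    from eq[OF n] show ?thesis
      unfolding fourier_laplace_eqI[OF u \<kappa>(1) n] fourier_laplace_eqI[OF v \<kappa>(1) n]
      using cutoff_exp_schwartz[OF \<kappa>(1) n] by (simp add: w_def)
  qed
  have "w \<psi> = 0" if \<psi>: "\<psi> \<in> schwartz_space" for \<psi>
  proof -
    have \<kappa>\<psi>: "(\<lambda>t. \<kappa> t * \<psi> t) \<in> schwartz_space"
      by (rule schwartz_smooth_mult[OF \<kappa>s half_line_cutoff_bounded[OF \<kappa>(1)] \<psi>])
    have \<eta>: "(\<lambda>t. \<psi> t - \<kappa> t * \<psi> t) \<in> schwartz_space"
      using schwartz_add[OF \<psi> schwartz_cmult[OF \<kappa>\<psi>, of "-1"]] by simp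
    have "w (\<lambda>t. \<psi> t - \<kappa> t * \<psi> t) = 0"
      by (rule tempered_eq_0_left[OF w \<kappa> \<eta>]) (use \<kappa>(3) in auto)
    moreover have "w (\<lambda>t. \<kappa> t * \<psi> t) = 0"
      by (rule tempered_eq_0_of_cutoff[OF w(1) \<kappa>(1,2) zero \<psi>])
    ultimately show ?thesis using tempered_diff[OF w(1) \<psi> \<kappa>\<psi>] by simp
  qed
  then have "u \<psi> = v \<psi>" if "\<psi> \<in> schwartz_space" for \<psi> using that by (simp add: w_def)
  then show ?thesis
    using u(1) v(1) by (auto simp: tempered_distribution_def intro: extensionalityI)
qed

lemma inverse_fourier_laplace_eqI:
  assumes "tempered_distribution u" "supported_in u {0..}"
    and "\<And>\<omega>. Im \<omega> > 0 \<Longrightarrow> fourier_laplace u \<omega> = g \<omega>"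
  shows "inverse_fourier_laplace g = u"
  unfolding inverse_fourier_laplace_def
  by (rule the_equality) (use assms in \<open>auto intro: fourier_laplace_inj\<close>)

section \<open>Superpositions of a function of polynomial growth\<close>

lemma integrable_inverse_square:
  fixes f :: "real \<Rightarrow> 'a :: {banach, second_countable_topology}"
  assumes [measurable]: "f \<in> borel_measurable borel" and "\<And>x. norm (f x) \<le> C / (1 + x ^ 2)"
  shows "integrable lborel f"
proof -
  have "integrable lborel (\<lambda>x. inverse (1 + x ^ 2) :: real)"
    using integrable_inverse_1_plus_square by (simp add: set_integrable_def)
  from integrable_mult_right[OF this, of C] show ?thesis
  proof (rule Bochner_Integration.integrable_bound)
    show "AE x in lborel. norm (f x) \<le> norm (C * inverse (1 + x\<^sup>2))"
      using order_trans[OF assms(2) abs_ge_self] by (simp add: divide_inverse)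
  qed simp
qed

lemma norm_lebesgue_integral_le:
  fixes f :: "'a \<Rightarrow> 'b :: {banach, second_countable_topology}"
  assumes "integrable M f" "integrable M g" "\<And>x. norm (f x) \<le> g x"
  shows "norm (integral\<^sup>L M f) \<le> integral\<^sup>L M g"
  using integral_norm_bound[of M f] Bochner_Integration.integral_mono[OF integrable_norm[OF assms(1)] assms(2,3)]
  by linarith

lemma one_plus_square_le: "1 + x ^ 2 \<le> (1 + \<bar>x\<bar>) ^ 2" for x :: real
  by (simp add: power2_eq_square algebra_simps flip: abs_mult)

text \<open>Adding exp y \<ge> 1 + y + y^2/2 and exp (-y) \<ge> 1 - y for y = \<bar>x\<bar> gives
  cosh x \<ge> 1 + y^2/4, and 1 + y^2/4 - y is the square of y/2 - 1. The bound controls both the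
  range of \<beta> and the decay of exp (\<i> \<omega> \<rho> cosh \<beta>).\<close>

lemma abs_le_cosh: "\<bar>x\<bar> \<le> cosh x" for x :: real
proof -
  have "1 + \<bar>x\<bar> + \<bar>x\<bar>\<^sup>2 / 2 \<le> exp \<bar>x\<bar>" by (rule exp_lower_Taylor_quadratic) simp
  moreover have "1 + - \<bar>x\<bar> \<le> exp (- \<bar>x\<bar>)" by (rule exp_ge_add_one_self)
  moreover have "2 * cosh x = exp \<bar>x\<bar> + exp (- \<bar>x\<bar>)" by (auto simp: cosh_def abs_if)
  moreover have "0 \<le> (\<bar>x\<bar> / 2 - 1)\<^sup>2" by simp
  then have "2 * \<bar>x\<bar> \<le> 2 + \<bar>x\<bar>\<^sup>2 / 2" by (simp add: power2_eq_square algebra_simps)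
  ultimately show ?thesis by linarith
qed

section \<open>Regular distributions given by functions of polynomial growth\<close>

lemma tempered_distribution_of_function:
  fixes G :: "real \<Rightarrow> complex"
  assumes [measurable]: "G \<in> borel_measurable borel" and G: "\<And>t. norm (G t) \<le> K * (1 + \<bar>t\<bar>) ^ m"
  defines "u \<equiv> \<lambda>\<psi>\<in>schwartz_space. LINT t|lebesgue. G t * \<psi> t"
  shows "given_by_function u G" "tempered_distribution u"
proof -
  \<comment> \<open>Of the m + 2 powers, m absorb the growth of G and 2 leave the integrable
    majorant 1 / (1 + t^2).\<close>
  let ?S = "\<lambda>\<psi>. schwartz_seminorm 0 0 \<psi> + schwartz_seminorm (m + 2) 0 \<psi>"
  have K: "K \<ge> 0" using order_trans[OF norm_ge_zero G[of 0]] by simp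
  have meas: "\<psi> \<in> borel_measurable borel" if "\<psi> \<in> schwartz_space" for \<psi>
    using that by (intro borel_measurable_continuous_onI continuous_on_smooth_fun schwartz_smooth)
  have le: "norm (G t * \<psi> t) \<le> (K * (2 ^ (m + 2) * ?S \<psi>)) / (1 + t ^ 2)" if \<psi>: "\<psi> \<in> schwartz_space" for \<psi> t
  proof -
    have "norm (G t * \<psi> t) * (1 + t ^ 2) \<le> (K * (1 + \<bar>t\<bar>) ^ m * norm (\<psi> t)) * (1 + \<bar>t\<bar>) ^ 2"
      unfolding norm_mult by (intro mult_mono G one_plus_square_le) (auto simp: K)
    also have "\<dots> = K * ((1 + \<bar>t\<bar>) ^ (m + 2) * norm (\<psi> t))" by (simp add: power_add power2_eq_square mult_ac)
    also have "\<dots> \<le> K * (2 ^ (m + 2) * ?S \<psi>)"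
      using schwartz_weight_le[OF \<psi>, of t "m + 2" 0] K by (intro mult_left_mono) simp_all
    finally show ?thesis by (simp add: pos_le_divide_eq add_pos_nonneg)
  qed
  have int: "integrable lborel (\<lambda>t. G t * \<psi> t)" if \<psi>: "\<psi> \<in> schwartz_space" for \<psi>
  proof (rule integrable_inverse_square[OF _ le[OF \<psi>]])
    note [measurable] = meas[OF \<psi>]
    show "(\<lambda>t. G t * \<psi> t) \<in> borel_measurable borel" by measurable
  qed
  have u: "u \<psi> = (LINT t|lborel. G t * \<psi> t)" if "\<psi> \<in> schwartz_space" for \<psi>
    using that meas[OF that] unfolding u_def by (simp add: integral_completion)
  show "given_by_function u G"
    unfolding given_by_function_def
  proof (intro conjI ballI)
    fix \<psi> assume \<psi>: "\<psi> \<in> schwartz_space"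
    show "integrable lebesgue (\<lambda>t. G t * \<psi> t)"
      using int[OF \<psi>] meas[OF \<psi>] by (subst integrable_completion) auto
  qed (simp add: u_def)
  define I where "I = (LINT t|lborel. 1 / (1 + t ^ 2 :: real))"
  have Iint: "integrable lborel (\<lambda>t :: real. 1 / (1 + t ^ 2))"
    by (rule integrable_inverse_square[where C = 1]) auto
  have I: "I \<ge> 0" unfolding I_def by (rule integral_nonneg_AE) simp
  show "tempered_distribution u"
    unfolding tempered_distribution_def
  proof (intro conjI ballI allI)
    show "u \<in> extensional schwartz_space" by (simp add: u_def)
    show "u (\<lambda>t. \<psi> t + \<zeta> t) = u \<psi> + u \<zeta>" if "\<psi> \<in> schwartz_space" "\<zeta> \<in> schwartz_space" for \<psi> \<zeta>
      using that by (simp add: u schwartz_add distrib_left int)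
    show "u (\<lambda>t. c * \<psi> t) = c * u \<psi>" if "\<psi> \<in> schwartz_space" for c \<psi>
      using that by (simp add: u schwartz_cmult mult.left_commute)
    show "\<exists>C N. \<forall>\<psi>\<in>schwartz_space. norm (u \<psi>) \<le> C * (\<Sum>k\<le>N. \<Sum>j\<le>N. schwartz_seminorm k j \<psi>)"
    proof (intro exI ballI)
      fix \<psi> assume \<psi>: "\<psi> \<in> schwartz_space"
      let ?T = "\<Sum>k\<le>m+2. \<Sum>j\<le>m+2. schwartz_seminorm k j \<psi>"
      have T: "schwartz_seminorm k 0 \<psi> \<le> ?T" if "k \<le> m + 2" for k
      proof -
        have "schwartz_seminorm k 0 \<psi> \<le> (\<Sum>j\<le>m+2. schwartz_seminorm k j \<psi>)"
          by (rule member_le_sum) (use schwartz_seminorm_nonneg[OF \<psi>] in auto)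
        also have "\<dots> \<le> ?T"
          by (rule member_le_sum) (use that in \<open>auto intro!: sum_nonneg add_nonneg_nonneg schwartz_seminorm_nonneg[OF \<psi>]\<close>)
        finally show ?thesis .
      qed
      have "norm (u \<psi>) \<le> (LINT t|lborel. (K * (2 ^ (m + 2) * ?S \<psi>)) * (1 / (1 + t ^ 2)))"
        unfolding u[OF \<psi>]
      proof (rule norm_lebesgue_integral_le[OF int[OF \<psi>]])
        show "integrable lborel (\<lambda>t. (K * (2 ^ (m + 2) * ?S \<psi>)) * (1 / (1 + t ^ 2)))"
          using Iint by (rule integrable_mult_right)
      qed (use le[OF \<psi>] in simp)
      also have "\<dots> = (K * 2 ^ (m + 2) * I) * ?S \<psi>"
        unfolding I_def integral_mult_right_zero by (simp only: mult_ac)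
      also have "\<dots> \<le> (K * 2 ^ (m + 2) * I) * (?T + ?T)"
        using K I by (intro mult_left_mono add_mono T) auto
      finally show "norm (u \<psi>) \<le> (2 * (K * 2 ^ (m + 2) * I)) * ?T"
        unfolding mult_2[symmetric] by (simp only: mult_ac)
    qed
  qed
qed

lemma supported_in_of_function:
  assumes "\<And>t. t < 0 \<Longrightarrow> G t = 0"
  shows "supported_in (\<lambda>\<psi>\<in>schwartz_space. LINT t|lebesgue. G t * \<psi> t) {0..}"
  unfolding supported_in_def
proof (intro allI impI)
  fix \<psi> assume \<psi>: "smooth_fun \<psi> \<and> compact (closure {t. \<psi> t \<noteq> 0}) \<and> closure {t. \<psi> t \<noteq> 0} \<inter> {0..} = {}"
  have "(\<lambda>t. G t * \<psi> t) = (\<lambda>t. 0)"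
  proof
    fix t show "G t * \<psi> t = 0"
      using assms[of t] \<psi> closure_subset[of "{t. \<psi> t \<noteq> 0}"] by (cases "t < 0") auto
  qed
  then show "(\<lambda>\<psi>\<in>schwartz_space. LINT t|lebesgue. G t * \<psi> t) \<psi> = 0"
    using \<psi> compact_support_schwartz[of \<psi>] by simp
qed

lemma fourier_laplace_of_function:
  fixes G :: "real \<Rightarrow> complex"
  assumes [measurable]: "G \<in> borel_measurable borel" and "\<And>t. norm (G t) \<le> K * (1 + \<bar>t\<bar>) ^ m"
    and "\<And>t. t < 0 \<Longrightarrow> G t = 0" and "Im \<omega> > 0"
  shows "fourier_laplace (\<lambda>\<psi>\<in>schwartz_space. LINT t|lebesgue. G t * \<psi> t) \<omega>
    = (LINT t|lborel. exp (\<i> * \<omega> * of_real t) * G t)"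
proof -
  obtain \<kappa> where \<kappa>: "half_line_cutoff \<kappa>" "\<And>t. t < -1 \<Longrightarrow> \<kappa> t = 0" "\<And>t. t > -1/2 \<Longrightarrow> \<kappa> t = 1"
    using cutoff_exists by blast
  \<comment> \<open>The cutoff disappears: G is 0 for t < 0, and \<kappa> is 1 for t \<ge>
    0.\<close>
  have "(\<lambda>t. G t * (\<kappa> t * exp (\<i> * \<omega> * of_real t))) = (\<lambda>t. exp (\<i> * \<omega> * of_real t) * G t)"
  proof
    fix t show "G t * (\<kappa> t * exp (\<i> * \<omega> * of_real t)) = exp (\<i> * \<omega> * of_real t) * G t"
      using assms(3)[of t] \<kappa>(3)[of t] by (cases "t < 0") auto
  qed
  moreover have "(\<lambda>t. exp (\<i> * \<omega> * of_real t) * G t) \<in> borel_measurable lborel"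
    by measurable
  moreover have "fourier_laplace (\<lambda>\<psi>\<in>schwartz_space. LINT t|lebesgue. G t * \<psi> t) \<omega>
      = (\<lambda>\<psi>\<in>schwartz_space. LINT t|lebesgue. G t * \<psi> t) (\<lambda>t. \<kappa> t * exp (\<i> * \<omega> * of_real t))"
    by (intro fourier_laplace_eqI tempered_distribution_of_function(2)[OF assms(1,2)]
        supported_in_of_function assms(3,4) \<kappa>(1))
  ultimately show ?thesis
    using cutoff_exp_schwartz[OF \<kappa>(1) assms(4)] by (simp add: integral_completion)
qed

lemma borel_measurable_cosh [measurable]: "(cosh :: real \<Rightarrow> real) \<in> borel_measurable borel"
  by (intro borel_measurable_continuous_onI continuous_intros)

section \<open>Superposition integrals with an abstract bounded weight\<close>

context
  fixes F Z :: "real \<Rightarrow> complex" and M B \<rho> :: real and m :: nat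
  assumes F_meas [measurable]: "F \<in> borel_measurable borel"
    and F_le: "\<And>s. norm (F s) \<le> M * (1 + \<bar>s\<bar>) ^ m"
    and F_0: "\<And>s. s < 0 \<Longrightarrow> F s = 0"
    and Z_meas [measurable]: "Z \<in> borel_measurable borel"
    and Z_le: "\<And>\<beta>. norm (Z \<beta>) \<le> B"
    and \<rho>: "\<rho> > 0"
begin

lemma M_nonneg: "M \<ge> 0" using order_trans[OF norm_ge_zero F_le[of 0]] by simp

lemma B_nonneg: "B \<ge> 0" using order_trans[OF norm_ge_zero Z_le[of 0]] .

text \<open>A nonzero value of F forces \<rho> \<bar>\<beta>\<bar> \<le> \<rho> cosh \<beta> \<le>
  t. So for fixed t the integrand lives on a bounded interval, and F is evaluated between 0 and
  t.\<close>

lemma superposition_le: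
  "norm (Z \<beta> * F (t - \<rho> * cosh \<beta>)) \<le> B * M * (1 + \<bar>t\<bar>) ^ m * indicator {- \<bar>t\<bar> / \<rho>..\<bar>t\<bar> / \<rho>} \<beta>"
proof (cases "t - \<rho> * cosh \<beta> < 0")
  case True
  then show ?thesis using F_0[OF True] M_nonneg B_nonneg by simp
next
  case False
  have "\<rho> * \<bar>\<beta>\<bar> \<le> \<rho> * cosh \<beta>" using \<rho> abs_le_cosh by simp
  moreover have "\<rho> * cosh \<beta> \<ge> 0" using \<rho> cosh_real_nonneg by simp
  ultimately have t: "\<rho> * \<bar>\<beta>\<bar> \<le> t" "\<bar>t - \<rho> * cosh \<beta>\<bar> \<le> \<bar>t\<bar>" using False by auto
  then have "\<bar>\<beta>\<bar> \<le> \<bar>t\<bar> / \<rho>" using \<rho> by (simp add: field_simps)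
  then have "\<beta> \<in> {- \<bar>t\<bar> / \<rho>..\<bar>t\<bar> / \<rho>}" by auto
  moreover have "norm (Z \<beta>) * norm (F (t - \<rho> * cosh \<beta>)) \<le> B * (M * (1 + \<bar>t\<bar>) ^ m)"
  proof (intro mult_mono Z_le order_trans[OF F_le] mult_left_mono power_mono)
  qed (use t M_nonneg B_nonneg in auto)
  ultimately show ?thesis by (simp add: norm_mult mult.assoc)
qed

lemma integrable_superposition_bound:
  "integrable lborel (\<lambda>\<beta>. B * M * (1 + \<bar>t\<bar>) ^ m * indicator {- \<bar>t\<bar> / \<rho>..\<bar>t\<bar> / \<rho>} \<beta>)"
  by (intro integrable_mult_right integrable_real_indicator) (auto simp: emeasure_lborel_Icc_eq)

lemma integrable_superposition: "integrable lborel (\<lambda>\<beta>. Z \<beta> * F (t - \<rho> * cosh \<beta>))"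
proof (rule Bochner_Integration.integrable_bound[OF integrable_superposition_bound[of t]])
  show "AE \<beta> in lborel. norm (Z \<beta> * F (t - \<rho> * cosh \<beta>))
      \<le> norm (B * M * (1 + \<bar>t\<bar>) ^ m * indicator {- \<bar>t\<bar> / \<rho>..\<bar>t\<bar> / \<rho>} \<beta>)"
    using order_trans[OF superposition_le abs_ge_self] by simp
qed measurable

lemma superposition_measurable:
  "(\<lambda>t. LINT \<beta>|lborel. Z \<beta> * F (t - \<rho> * cosh \<beta>)) \<in> borel_measurable borel"
  by measurable

lemma superposition_eq_0:
  assumes "t < 0"
  shows "(LINT \<beta>|lborel. Z \<beta> * F (t - \<rho> * cosh \<beta>)) = 0"
proof -
  have "t - \<rho> * cosh \<beta> < 0" for \<beta>
    using assms \<rho> mult_nonneg_nonneg[of \<rho> "cosh \<beta>"] cosh_real_nonneg[of \<beta>] by linarith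
  then show ?thesis using F_0 by simp
qed

text \<open>The interval of integration has length 2 \<bar>t\<bar> / \<rho>, which raises the degree
  of growth by one.\<close>

lemma norm_superposition_le:
  "norm (LINT \<beta>|lborel. Z \<beta> * F (t - \<rho> * cosh \<beta>)) \<le> (2 * B * M / \<rho>) * (1 + \<bar>t\<bar>) ^ Suc m"
proof -
  have "norm (LINT \<beta>|lborel. Z \<beta> * F (t - \<rho> * cosh \<beta>))
      \<le> (LINT \<beta>|lborel. B * M * (1 + \<bar>t\<bar>) ^ m * indicator {- \<bar>t\<bar> / \<rho>..\<bar>t\<bar> / \<rho>} \<beta>)"
    by (rule norm_lebesgue_integral_le[OF integrable_superposition integrable_superposition_bound superposition_le])
  also have "\<dots> = (2 * B * M / \<rho>) * (1 + \<bar>t\<bar>) ^ m * \<bar>t\<bar>"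
    using \<rho> by (simp add: divide_right_mono)
  also have "\<dots> \<le> (2 * B * M / \<rho>) * (1 + \<bar>t\<bar>) ^ m * (1 + \<bar>t\<bar>)"
    using \<rho> M_nonneg B_nonneg by (intro mult_left_mono) auto
  finally show ?thesis by (simp add: mult_ac)
qed

lemma fourier_laplace_superposition:
  assumes \<omega>: "Im \<omega> > 0"
  shows "(LINT t|lborel. exp (\<i> * \<omega> * of_real t) * (LINT \<beta>|lborel. Z \<beta> * F (t - \<rho> * cosh \<beta>)))
    = (LINT s|lborel. exp (\<i> * \<omega> * of_real s) * F s)
      * (LINT \<beta>|lborel. exp (\<i> * \<omega> * of_real (\<rho> * cosh \<beta>)) * Z \<beta>)"
proof -
  let ?e = "\<lambda>t. exp (\<i> * \<omega> * complex_of_real t)"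
  have e_add: "?e (s + t) = ?e s * ?e t" for s t by (simp add: exp_add distrib_left)
  have ne: "norm (?e t) = exp (- Im \<omega> * t)" for t by simp
  have eF: "integrable lborel (\<lambda>s. ?e s * F s)"
  proof -
    obtain D where D: "\<And>s. s \<ge> 0 \<Longrightarrow> (1 + \<bar>s\<bar>) ^ (m + 2) * exp (- Im \<omega> * s) \<le> D"
      using power_exp_bounded[OF \<omega>, of 0 "m + 2"] by blast
    have D0: "D \<ge> 0" using D[of 0] by simp
    show ?thesis
    proof (rule integrable_inverse_square)
      show "norm (?e s * F s) \<le> (M * D) / (1 + s ^ 2)" for s
      proof (cases "s < 0")
        case True
        then show ?thesis using F_0 M_nonneg D0 by simp
      next
        case False
        have "norm (?e s * F s) * (1 + s ^ 2) \<le> (exp (- Im \<omega> * s) * (M * (1 + \<bar>s\<bar>) ^ m)) * (1 + \<bar>s\<bar>) ^ 2"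
          unfolding norm_mult ne by (intro mult_mono F_le one_plus_square_le) (auto simp: M_nonneg)
        also have "\<dots> = M * ((1 + \<bar>s\<bar>) ^ (m + 2) * exp (- Im \<omega> * s))" by (simp add: power_add power2_eq_square mult_ac)
        also have "\<dots> \<le> M * D" using D[of s] False M_nonneg by (intro mult_left_mono) auto
        finally show ?thesis by (simp add: pos_le_divide_eq add_pos_nonneg)
      qed
    qed measurable
  qed
  have eZ: "integrable lborel (\<lambda>\<beta>. ?e (\<rho> * cosh \<beta>) * Z \<beta>)"
  proof -
    have a: "Im \<omega> * \<rho> > 0" using \<omega> \<rho> by simp
    obtain D where D: "\<And>s. s \<ge> 0 \<Longrightarrow> (1 + \<bar>s\<bar>) ^ 2 * exp (- (Im \<omega> * \<rho>) * s) \<le> D"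
      using power_exp_bounded[OF a, of 0 2] by blast
    show ?thesis
    proof (rule integrable_inverse_square)
      show "norm (?e (\<rho> * cosh \<beta>) * Z \<beta>) \<le> (D * B) / (1 + \<beta> ^ 2)" for \<beta>
      proof -
        have "exp (- Im \<omega> * (\<rho> * cosh \<beta>)) \<le> exp (- (Im \<omega> * \<rho>) * \<bar>\<beta>\<bar>)"
          using mult_left_mono[OF abs_le_cosh[of \<beta>], of "Im \<omega> * \<rho>"] a by (simp add: mult_ac)
        then have "exp (- Im \<omega> * (\<rho> * cosh \<beta>)) * (1 + \<beta> ^ 2) \<le> exp (- (Im \<omega> * \<rho>) * \<bar>\<beta>\<bar>) * (1 + \<bar>\<beta>\<bar>) ^ 2"
          by (intro mult_mono one_plus_square_le) auto
        also have "\<dots> \<le> D" using D[of "\<bar>\<beta>\<bar>"] by (simp add: mult.commute)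
        finally have "exp (- Im \<omega> * (\<rho> * cosh \<beta>)) * (1 + \<beta> ^ 2) * norm (Z \<beta>) \<le> D * B"
          by (intro mult_mono Z_le) (auto intro: order_trans[rotated])
        then show ?thesis
          unfolding norm_mult ne by (simp add: pos_le_divide_eq add_pos_nonneg mult_ac)
      qed
    qed measurable
  qed
  define f where "f \<beta> t = ?e t * (Z \<beta> * F (t - \<rho> * cosh \<beta>))" for \<beta> t
  have f_meas [measurable]: "case_prod f \<in> borel_measurable (lborel \<Otimes>\<^sub>M lborel)"
    unfolding f_def[abs_def] by measurable
  \<comment> \<open>Translating t by \<rho> cosh \<beta> separates the variables, so the double
    integral and its absolute version both factor. The redundant slope in \<open>1 * s\<close> fits
    the affine substitution rules.\<close>
  have f_shift: "f \<beta> (\<rho> * cosh \<beta> + 1 * s) = (?e (\<rho> * cosh \<beta>) * Z \<beta>) * (?e s * F s)" for \<beta> s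
    unfolding f_def by (simp add: e_add del: of_real_add of_real_mult)
  have f_int: "integrable lborel (f \<beta>)" for \<beta>
  proof -
    have "integrable lborel (\<lambda>s. f \<beta> (\<rho> * cosh \<beta> + 1 * s))"
      unfolding f_shift by (intro integrable_mult_right eF)
    then show ?thesis by (subst (asm) lborel_integrable_real_affine_iff) auto
  qed
  have "integrable (lborel \<Otimes>\<^sub>M lborel) (case_prod f)"
  proof (rule lborel_pair.Fubini_integrable)
    have "(LINT t|lborel. norm (f \<beta> t)) = norm (?e (\<rho> * cosh \<beta>) * Z \<beta>) * (LINT s|lborel. norm (?e s * F s))" for \<beta>
      using lborel_integral_real_affine[of 1 "\<lambda>t. norm (f \<beta> t)" "\<rho> * cosh \<beta>"]
      unfolding f_shift norm_mult[of "?e (\<rho> * cosh \<beta>) * Z \<beta>"] by simp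
    then show "integrable lborel (\<lambda>\<beta>. LINT t|lborel. norm (case_prod f (\<beta>, t)))"
      using eZ by simp
  qed (use f_int in auto)
  from lborel_pair.Fubini_integral[OF this]
  have "(LINT t|lborel. LINT \<beta>|lborel. f \<beta> t) = (LINT \<beta>|lborel. LINT t|lborel. f \<beta> t)" by simp
  also have "\<dots> = (LINT \<beta>|lborel. (?e (\<rho> * cosh \<beta>) * Z \<beta>) * (LINT s|lborel. ?e s * F s))"
  proof (rule Bochner_Integration.integral_cong[OF refl])
    fix \<beta>
    show "(LINT t|lborel. f \<beta> t) = (?e (\<rho> * cosh \<beta>) * Z \<beta>) * (LINT s|lborel. ?e s * F s)"
      using lborel_integral_real_affine[of 1 "f \<beta>" "\<rho> * cosh \<beta>"] unfolding f_shift by simp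
  qed
  finally show ?thesis unfolding f_def by (simp add: mult.commute)
qed

end

section \<open>The diffraction kernel\<close>

lemma norm_cosh_le: "norm (cosh z) \<le> cosh (Re z)" for z :: complex
proof -
  have "norm (exp z + exp (- z)) \<le> exp (Re z) + exp (- Re z)"
    using norm_triangle_ineq[of "exp z" "exp (- z)"] by simp
  then show ?thesis by (simp add: cosh_def)
qed

text \<open>The left-hand side is the modulus of the imaginary part of sinh z.\<close>

lemma norm_sinh_ge: "cosh (Re z) * \<bar>sin (Im z)\<bar> \<le> norm (sinh z)" for z :: complex
proof -
  have "Im (sinh z) = cosh (Re z) * sin (Im z)"
    by (simp add: sinh_def cosh_def Im_exp algebra_simps)
  then have "cosh (Re z) * \<bar>sin (Im z)\<bar> = \<bar>Im (sinh z)\<bar>"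
    by (simp add: abs_mult)
  then show ?thesis using abs_Im_le_cmod[of "sinh z"] by linarith
qed

text \<open>On a horizontal line the factor cosh (Re z) cancels between numerator and denominator of
  coth, and for 1 / sinh it is at least 1. The bounds depend on Im z alone.\<close>

lemma
  assumes "sin (Im z) \<noteq> 0"
  shows sinh_complex_nonzero: "sinh z \<noteq> 0"
    and norm_coth_le: "norm (coth z) \<le> 1 / \<bar>sin (Im z)\<bar>"
    and norm_inverse_sinh_le: "norm (1 / sinh z) \<le> 1 / \<bar>sin (Im z)\<bar>"
proof -
  have c: "cosh (Re z) \<ge> 1" by (rule cosh_real_ge_1)
  have s: "\<bar>sin (Im z)\<bar> > 0" using assms by simp
  have pos: "cosh (Re z) * \<bar>sin (Im z)\<bar> > 0" using c s by (intro mult_pos_pos) auto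
  then show nz: "sinh z \<noteq> 0" using norm_sinh_ge[of z] by auto
  have "norm (coth z) \<le> cosh (Re z) / (cosh (Re z) * \<bar>sin (Im z)\<bar>)"
    unfolding coth_def norm_divide using pos c by (intro frac_le norm_cosh_le norm_sinh_ge) auto
  then show "norm (coth z) \<le> 1 / \<bar>sin (Im z)\<bar>" using c by simp
  have "1 * \<bar>sin (Im z)\<bar> \<le> cosh (Re z) * \<bar>sin (Im z)\<bar>" using c by (intro mult_right_mono) auto
  then have "\<bar>sin (Im z)\<bar> \<le> norm (sinh z)" using norm_sinh_ge[of z] by simp
  then show "norm (1 / sinh z) \<le> 1 / \<bar>sin (Im z)\<bar>"
    unfolding norm_divide using s by (intro frac_le) auto
qed

text \<open>What the superposition estimates ask of the kernel, Borel measurability (through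
  continuity) and a bound, packaged so as to be closed under sums; this treats the three boundary
  types together.\<close>

definition bounded_continuous :: "(real \<Rightarrow> complex) \<Rightarrow> bool" where
  "bounded_continuous f \<longleftrightarrow> continuous_on UNIV f \<and> (\<exists>B. \<forall>x. norm (f x) \<le> B)"

lemma bounded_continuous_add:
  assumes "bounded_continuous f" "bounded_continuous g"
  shows "bounded_continuous (\<lambda>x. f x + g x)"
  using assms unfolding bounded_continuous_def
  by (auto intro!: continuous_on_add) (meson norm_triangle_mono)

lemma bounded_continuous_uminus: "bounded_continuous f \<Longrightarrow> bounded_continuous (\<lambda>x. - f x)"
  unfolding bounded_continuous_def by (auto intro!: continuous_on_minus)

lemma bounded_continuous_diff:
  assumes "bounded_continuous f" "bounded_continuous g"
  shows "bounded_continuous (\<lambda>x. f x - g x)"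
  using bounded_continuous_add[OF assms(1) bounded_continuous_uminus[OF assms(2)]] by simp

lemma
  fixes q \<gamma> :: real
  assumes "sin (q * \<gamma>) \<noteq> 0"
  shows bounded_continuous_coth: "bounded_continuous (\<lambda>\<beta>. coth (of_real q * (of_real \<beta> + \<i> * of_real \<gamma>)))"
    and bounded_continuous_inverse_sinh:
      "bounded_continuous (\<lambda>\<beta>. 1 / sinh (of_real q * (of_real \<beta> + \<i> * of_real \<gamma>)))"
proof -
  have s: "sin (Im (of_real q * (of_real \<beta> + \<i> * of_real \<gamma>))) \<noteq> 0" for \<beta> using assms by simp
  have "continuous_on UNIV (\<lambda>\<beta>. coth (of_real q * (of_real \<beta> + \<i> * of_real \<gamma>)))"
    "continuous_on UNIV (\<lambda>\<beta>. 1 / sinh (complex_of_real q * (of_real \<beta> + \<i> * of_real \<gamma>)))"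
    unfolding coth_def by (intro continuous_intros ballI sinh_complex_nonzero s)+
  then show "bounded_continuous (\<lambda>\<beta>. coth (of_real q * (of_real \<beta> + \<i> * of_real \<gamma>)))"
    "bounded_continuous (\<lambda>\<beta>. 1 / sinh (of_real q * (of_real \<beta> + \<i> * of_real \<gamma>)))"
    unfolding bounded_continuous_def
    using norm_coth_le[OF s] norm_inverse_sinh_le[OF s] by auto
qed

lemma sin_wedge_nonzero:
  assumes "\<gamma> / (2 * wedge_Phi \<phi>) \<notin> \<int>"
  shows "sin (wedge_q \<phi> * \<gamma>) \<noteq> 0"
proof
  assume "sin (wedge_q \<phi> * \<gamma>) = 0"
  then obtain i where "wedge_q \<phi> * \<gamma> = of_int i * pi" unfolding sin_zero_iff_int2 by blast
  then have "pi * (\<gamma> / (2 * wedge_Phi \<phi>)) = pi * of_int i" by (simp add: wedge_q_def mult_ac)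
  then have "\<gamma> / (2 * wedge_Phi \<phi>) = of_int i" by (rule mult_left_cancel[OF pi_neq_zero, THEN iffD1])
  then show False using assms by simp
qed

lemma real_between_ints_notin_Ints:
  fixes x :: real
  assumes "of_int n < x" "x < of_int n + 1"
  shows "x \<notin> \<int>"
proof
  assume "x \<in> \<int>"
  then obtain i where "x = of_int i" by (rule Ints_cases)
  then have "n < i" "i < n + 1" using assms by linarith+
  then show False by simp
qed

text \<open>The kernel involves four lines with imaginary parts \<theta> - \<alpha>, \<theta> +
  \<alpha> - 2\<pi>, \<theta> - \<alpha> - 2\<pi> and \<theta> + \<alpha> - 4\<pi> before scaling by
  q, and poles sit at multiples of 2\<Phi>. Each value is placed strictly between two consecutive
  multiples.\<close>

lemma bounded_continuous_kernel_Z: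
  assumes "0 < \<phi>" "\<phi> < pi" "max 0 (\<phi> - pi / 2) < \<alpha>" "\<alpha> < min (pi / 2) \<phi>" "\<theta> \<in> wedge_Theta \<phi> \<alpha>"
  shows "bounded_continuous (\<lambda>\<beta>. kernel_Z bc \<phi> \<alpha> (of_real \<beta> + \<i> * of_real \<theta>))"
proof -
  let ?q = "wedge_q \<phi>"
  have \<theta>: "\<phi> \<le> \<theta>" "\<theta> \<le> 2 * pi" "\<theta> \<noteq> 2 * \<phi> - \<alpha>" "\<theta> \<noteq> 2 * pi - \<alpha>"
    using assms(5) by (auto simp: wedge_Theta_def)
  have P: "2 * wedge_Phi \<phi> > 0" using assms by (simp add: wedge_Phi_def)
  have nz: "sin (?q * \<gamma>) \<noteq> 0"
    if "of_int n * (2 * wedge_Phi \<phi>) < \<gamma>" "\<gamma> < (of_int n + 1) * (2 * wedge_Phi \<phi>)" for \<gamma> n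
    by (rule sin_wedge_nonzero, rule real_between_ints_notin_Ints[of n])
      (use that P in \<open>simp_all only: pos_less_divide_eq pos_divide_less_eq\<close>)
  have 1: "sin (?q * (\<theta> - \<alpha>)) \<noteq> 0"
    by (rule nz[of 0]) (use assms \<theta> in \<open>auto simp: wedge_Phi_def\<close>)
  \<comment> \<open>The value lies in (-2\<Phi>, 2\<Phi>) and meets the multiple 0 exactly at the
    excluded angle 2\<pi> - \<alpha>.\<close>
  have 2: "sin (?q * (\<theta> + \<alpha> - 2 * pi)) \<noteq> 0"
  proof (cases "\<theta> < 2 * pi - \<alpha>")
    case True
    show ?thesis by (rule nz[of "-1"]) (use True assms \<theta> in \<open>auto simp: wedge_Phi_def\<close>)
  next
    case False
    show ?thesis by (rule nz[of 0]) (use False assms \<theta> in \<open>auto simp: wedge_Phi_def\<close>)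
  qed
  have 3: "sin (?q * (\<theta> - \<alpha> - 2 * pi)) \<noteq> 0"
    by (rule nz[of "-1"]) (use assms \<theta> in \<open>auto simp: wedge_Phi_def\<close>)
  \<comment> \<open>The value lies in (-4\<Phi>, 0) and meets the multiple -2\<Phi> exactly at the
    excluded angle 2\<phi> - \<alpha>.\<close>
  have 4: "sin (?q * (\<theta> + \<alpha> - 4 * pi)) \<noteq> 0"
  proof (cases "\<theta> < 2 * \<phi> - \<alpha>")
    case True
    show ?thesis by (rule nz[of "-2"]) (use True assms \<theta> in \<open>auto simp: wedge_Phi_def\<close>)
  next
    case False
    show ?thesis by (rule nz[of "-1"]) (use False assms \<theta> in \<open>auto simp: wedge_Phi_def\<close>)
  qed
  have arg: "b + \<i> * of_real \<theta> - \<i> * of_real pi / 2 + \<i> * of_real pi / 2 - \<i> * of_real \<alpha> = b + \<i> * of_real (\<theta> - \<alpha>)"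
    "b + \<i> * of_real \<theta> - \<i> * of_real pi / 2 - 3 * \<i> * of_real pi / 2 + \<i> * of_real \<alpha> = b + \<i> * of_real (\<theta> + \<alpha> - 2 * pi)"
    "b + \<i> * of_real \<theta> - 5 * \<i> * of_real pi / 2 + \<i> * of_real pi / 2 - \<i> * of_real \<alpha> = b + \<i> * of_real (\<theta> - \<alpha> - 2 * pi)"
    "b + \<i> * of_real \<theta> - 5 * \<i> * of_real pi / 2 - 3 * \<i> * of_real pi / 2 + \<i> * of_real \<alpha> = b + \<i> * of_real (\<theta> + \<alpha> - 4 * pi)"
    for b :: complex
    by (simp_all add: complex_eq_iff)
  note bc = bounded_continuous_add bounded_continuous_diff bounded_continuous_uminus
    bounded_continuous_coth[OF 1] bounded_continuous_coth[OF 2] bounded_continuous_coth[OF 3] bounded_continuous_coth[OF 4]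
    bounded_continuous_inverse_sinh[OF 1] bounded_continuous_inverse_sinh[OF 2]
    bounded_continuous_inverse_sinh[OF 3] bounded_continuous_inverse_sinh[OF 4]
  show ?thesis
    by (cases bc; unfold kernel_Z_def; simp only: kernel_H.simps arg; intro bc)
qed

section \<open>Null sets and Borel representatives\<close>

text \<open>Away from the critical point \<beta> = 0 the map has the two inverse branches
  \<plusminus> arcosh ((t - s) / \<rho>), and differentiable images of null sets are null.\<close>

lemma negligible_cosh_vimage:
  fixes \<rho> t :: real
  assumes \<rho>: "\<rho> > 0" and N: "negligible N"
  shows "negligible {\<beta>. t - \<rho> * cosh \<beta> \<in> N}"
proof -
  \<comment> \<open>The strict inequality keeps away from the value 1, where arcosh is not
    differentiable; this costs only the point \<beta> = 0.\<close>
  define A where "A = N \<inter> {s. (t - s) / \<rho> > 1}"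
  let ?g = "\<lambda>s. arcosh ((t - s) / \<rho>)"
  have A: "negligible A" using N by (simp add: A_def negligible_Int)
  have "?g differentiable_on A"
    unfolding differentiable_on_def
  proof
    fix s assume "s \<in> A"
    then have "(t - s) / \<rho> > 1" by (simp add: A_def)
    then have "(?g has_real_derivative 1 / sqrt (((t - s) / \<rho>) ^ 2 - 1) * (- 1 / \<rho>)) (at s within A)"
      using \<rho> by (intro DERIV_chain2[where f = arcosh and g = "\<lambda>s. (t - s) / \<rho>"])
        (auto intro!: derivative_eq_intros simp: field_simps)
    then show "?g differentiable at s within A" 
      by (rule differentiableI[OF has_field_derivative_imp_has_derivative])
  qed
  then have g: "negligible (?g ` A)"
    by (intro negligible_differentiable_image_negligible A) auto
  have "negligible ((\<lambda>x. - x) ` (?g ` A))"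
    by (intro negligible_differentiable_image_negligible g derivative_intros) auto
  then have "negligible ({0} \<union> ?g ` A \<union> (\<lambda>x. - x) ` (?g ` A))"
    using g by (simp add: negligible_Un)
  moreover have "{\<beta>. t - \<rho> * cosh \<beta> \<in> N} \<subseteq> {0} \<union> ?g ` A \<union> (\<lambda>x. - x) ` (?g ` A)"
  proof
    fix \<beta> assume \<beta>: "\<beta> \<in> {\<beta>. t - \<rho> * cosh \<beta> \<in> N}"
    show "\<beta> \<in> {0} \<union> ?g ` A \<union> (\<lambda>x. - x) ` (?g ` A)"
    proof (cases "\<beta> = 0")
      case False
      have "cosh 0 < cosh \<bar>\<beta>\<bar>" using False by (intro cosh_real_strict_mono) auto
      then have "t - \<rho> * cosh \<beta> \<in> A" using \<beta> \<rho> by (simp add: A_def)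
      moreover have "?g (t - \<rho> * cosh \<beta>) = \<bar>\<beta>\<bar>"
        using \<rho> arcosh_cosh_real[of "\<bar>\<beta>\<bar>"] by simp
      ultimately have "\<bar>\<beta>\<bar> \<in> ?g ` A" by (metis image_eqI)
      moreover have "\<beta> = \<bar>\<beta>\<bar> \<or> \<beta> = - \<bar>\<beta>\<bar>" by auto
      ultimately show ?thesis by (metis UnI1 UnI2 imageI)
    qed simp
  qed
  ultimately show ?thesis by (rule negligible_subset)
qed

lemma lebesgue_measurable_of_locally_integrable:
  fixes F :: "real \<Rightarrow> complex"
  assumes "\<And>K. compact K \<Longrightarrow> F absolutely_integrable_on K"
  shows "F \<in> borel_measurable lebesgue"
proof (rule borel_measurable_LIMSEQ_metric)
  show "(\<lambda>x. indicator {- real n..real n} x *\<^sub>R F x) \<in> borel_measurable lebesgue" for n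
    using assms[of "{- real n..real n}"] unfolding set_integrable_def by auto
  show "(\<lambda>n. indicator {- real n..real n} x *\<^sub>R F x) \<longlonglongrightarrow> F x" for x
  proof (rule tendsto_eventually)
    obtain N where "\<bar>x\<bar> \<le> real N" using real_arch_simple by blast
    then show "\<forall>\<^sub>F n in sequentially. indicator {- real n..real n} x *\<^sub>R F x = F x"
      unfolding eventually_sequentially by (intro exI[of _ N]) (auto simp: indicator_def abs_le_iff)
  qed
qed

lemma borel_version:
  fixes F :: "real \<Rightarrow> complex"
  assumes "F \<in> borel_measurable lebesgue"
  obtains F' N where "F' \<in> borel_measurable borel" "negligible N" "\<And>x. x \<notin> N \<Longrightarrow> F x = F' x"
proof -
  have re: "(\<lambda>x. Re (F x)) \<in> borel_measurable lebesgue" and im: "(\<lambda>x. Im (F x)) \<in> borel_measurable lebesgue"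
    using assms by measurable
  from completion_ex_borel_measurable_real[OF re]
  obtain f where f: "f \<in> borel_measurable borel" "AE x in lborel. Re (F x) = f x" by auto
  from completion_ex_borel_measurable_real[OF im]
  obtain g where g: "g \<in> borel_measurable borel" "AE x in lborel. Im (F x) = g x" by auto
  note [measurable] = f(1) g(1)
  define F' where "F' x = complex_of_real (f x) + \<i> * complex_of_real (g x)" for x
  have "AE x in lborel. F x = F' x"
    using f(2) g(2) by eventually_elim (simp add: F'_def complex_eq_iff)
  then have "AE x in lebesgue. F x = F' x" by (rule AE_completion)
  then obtain N where N: "{x \<in> space lebesgue. F x \<noteq> F' x} \<subseteq> N" "emeasure lebesgue N = 0" "N \<in> sets lebesgue"
    by (rule AE_E)
  then have "negligible N" unfolding negligible_iff_null_sets by (simp add: null_sets_def)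
  moreover have "F' \<in> borel_measurable borel" unfolding F'_def[abs_def] by measurable
  ultimately show thesis by (intro that[of F' N]) (use N in auto)
qed

lemma polynomial_bound:
  fixes F :: "real \<Rightarrow> complex"
  assumes "bdd_above (range (\<lambda>s. (1 + \<bar>s\<bar>) powr p * norm (F s)))"
  obtains M m where "M \<ge> 0" "\<And>s. norm (F s) \<le> M * (1 + \<bar>s\<bar>) ^ m"
proof -
  from assms obtain M where M: "\<And>s. (1 + \<bar>s\<bar>) powr p * norm (F s) \<le> M"
    by (auto simp: bdd_above_def)
  have M0: "M \<ge> 0" using order_trans[OF _ M[of 0]] by simp
  \<comment> \<open>\<open>nat\<close> gives 0 for p \<ge> 0, when F is bounded; for negative p the
    exponent is rounded up.\<close>
  define m where "m = nat \<lceil>- p\<rceil>"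
  have m: "- p \<le> real m" unfolding m_def by linarith
  have "norm (F s) \<le> M * (1 + \<bar>s\<bar>) ^ m" for s
  proof -
    have "norm (F s) = ((1 + \<bar>s\<bar>) powr p * norm (F s)) * (1 + \<bar>s\<bar>) powr (- p)"
      by (simp add: powr_minus)
    also have "\<dots> \<le> M * (1 + \<bar>s\<bar>) powr real m"
      by (intro mult_mono M powr_mono m M0) auto
    finally show ?thesis by (simp add: powr_realpow)
  qed
  then show thesis by (rule that[OF M0])
qed

text \<open>By completeness of Lebesgue measure, preimages that differ within a null set are
  measurable together.\<close>

lemma borel_measurable_lebesgue_cong_AE:
  fixes f g :: "real \<Rightarrow> complex"
  assumes f: "f \<in> borel_measurable lebesgue" and ae: "AE x in lebesgue. f x = g x"
  shows "g \<in> borel_measurable lebesgue"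
proof (rule measurableI)
  fix A :: "complex set" assume A: "A \<in> sets borel"
  show "g -` A \<inter> space lebesgue \<in> sets lebesgue"
  proof (rule completion.in_sets_AE)
    show "f -` A \<inter> space lebesgue \<in> sets lebesgue" using f A by (rule measurable_sets)
    show "AE x in lebesgue. x \<in> f -` A \<inter> space lebesgue \<longleftrightarrow> x \<in> g -` A \<inter> space lebesgue"
      using ae by eventually_elim simp
  qed simp
qed simp

text \<open>Integrability in \<beta> is part of the conclusion because a divergent Bochner integral
  would silently count as 0.\<close>

theorem lemma3p5:
  fixes \<phi> \<alpha> \<rho> \<theta> :: real and F :: "real \<Rightarrow> complex" and bc :: boundary_type
  assumes "0 < \<phi>" and "\<phi> < pi"
    and "max 0 (\<phi> - pi / 2) < \<alpha>" and "\<alpha> < min (pi / 2) \<phi>"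
    and "\<And>K :: real set. compact K \<Longrightarrow> F absolutely_integrable_on K"
    and "\<And>s. s < 0 \<Longrightarrow> F s = 0"
    and "\<exists>p :: real. bdd_above (range (\<lambda>s. (1 + \<bar>s\<bar>) powr p * norm (F s)))"
    and "\<rho> > 0" and "\<theta> \<in> wedge_Theta \<phi> \<alpha>"
  shows "(\<forall>t :: real. integrable lebesgue
            (\<lambda>\<beta>. kernel_Z bc \<phi> \<alpha> (of_real \<beta> + \<i> * of_real \<theta>) * F (t - \<rho> * cosh \<beta>))) \<and>
         given_by_function (diffracted_wave bc \<phi> \<alpha> F \<rho> \<theta>)
           (\<lambda>t. \<i> / of_real (4 * wedge_Phi \<phi>) *
              (LINT \<beta>|lebesgue.
                 kernel_Z bc \<phi> \<alpha> (of_real \<beta> + \<i> * of_real \<theta>) * F (t - \<rho> * cosh \<beta>)))"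
proof -
  define Z where "Z \<beta> = kernel_Z bc \<phi> \<alpha> (of_real \<beta> + \<i> * of_real \<theta>)" for \<beta> :: real
  define c where "c = \<i> / complex_of_real (4 * wedge_Phi \<phi>)"
  have "bounded_continuous Z"
    unfolding Z_def[abs_def] by (intro bounded_continuous_kernel_Z assms)
  then obtain B where [measurable]: "Z \<in> borel_measurable borel" and Z_le: "\<And>\<beta>. norm (Z \<beta>) \<le> B"
    unfolding bounded_continuous_def by (auto intro: borel_measurable_continuous_onI)
  obtain M m where M: "M \<ge> 0" "\<And>s. norm (F s) \<le> M * (1 + \<bar>s\<bar>) ^ m"
    using assms(7) polynomial_bound by blast
  obtain F1 N where [measurable]: "F1 \<in> borel_measurable borel" and N: "negligible N" "\<And>x. x \<notin> N \<Longrightarrow> F x = F1 x"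
    using borel_version[OF lebesgue_measurable_of_locally_integrable[OF assms(5)]] by blast
  \<comment> \<open>The Borel representative may violate the support or growth condition on a null
    set; setting it to 0 there makes both hold everywhere. Agreement with F off N survives, as F
    satisfies both.\<close>
  define F0 where "F0 s = (if s \<ge> 0 \<and> norm (F1 s) \<le> M * (1 + \<bar>s\<bar>) ^ m then F1 s else 0)" for s
  have F0_meas [measurable]: "F0 \<in> borel_measurable borel" unfolding F0_def[abs_def] by measurable
  have F0_le: "norm (F0 s) \<le> M * (1 + \<bar>s\<bar>) ^ m" for s unfolding F0_def using M(1) by auto
  have F0_0: "F0 s = 0" if "s < 0" for s using that by (simp add: F0_def)
  have F0_eq: "F x = F0 x" if "x \<notin> N" for x
    using N(2)[OF that] M(2)[of x] assms(6)[of x] by (auto simp: F0_def)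
  note bound = F0_meas F0_le F0_0 \<open>Z \<in> borel_measurable borel\<close> Z_le \<open>\<rho> > 0\<close>
  define G where "G t = c * (LINT \<beta>|lborel. Z \<beta> * F0 (t - \<rho> * cosh \<beta>))" for t
  have F_meas: "F \<in> borel_measurable lebesgue"
    by (rule lebesgue_measurable_of_locally_integrable[OF assms(5)])
  have ae: "AE \<beta> in lebesgue. Z \<beta> * F0 (t - \<rho> * cosh \<beta>) = Z \<beta> * F (t - \<rho> * cosh \<beta>)" for t
  proof (rule AE_I')
    show "{\<beta>. t - \<rho> * cosh \<beta> \<in> N} \<in> null_sets lebesgue"
      using negligible_cosh_vimage[OF \<open>\<rho> > 0\<close> N(1)] by (simp add: negligible_iff_null_sets)
  qed (use F0_eq in fastforce)
  have m0: "(\<lambda>\<beta>. Z \<beta> * F0 (t - \<rho> * cosh \<beta>)) \<in> borel_measurable lborel" for t by measurable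
  \<comment> \<open>Composing a Lebesgue measurable function with a continuous map need not preserve
    measurability; here it is inherited from the Borel version through equality almost
    everywhere.\<close>
  have m: "(\<lambda>\<beta>. Z \<beta> * F (t - \<rho> * cosh \<beta>)) \<in> borel_measurable lebesgue" for t
    using measurable_completion[OF m0] ae by (rule borel_measurable_lebesgue_cong_AE)
  have int: "integrable lebesgue (\<lambda>\<beta>. Z \<beta> * F (t - \<rho> * cosh \<beta>))" for t
    using integrable_superposition[OF bound, of t] integrable_cong_AE[OF measurable_completion[OF m0] m ae, of t]
    unfolding integrable_completion[OF m0] by blast
  have G: "G t = c * (LINT \<beta>|lebesgue. Z \<beta> * F (t - \<rho> * cosh \<beta>))" for t
    using integral_cong_AE[OF measurable_completion[OF m0] m ae, of t]
    unfolding integral_completion[OF m0] by (simp add: G_def)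
  have G_meas: "G \<in> borel_measurable borel"
    unfolding G_def[abs_def] using superposition_measurable[OF bound] by measurable
  have G_le: "norm (G t) \<le> (norm c * (2 * B * M / \<rho>)) * (1 + \<bar>t\<bar>) ^ Suc m" for t
    using mult_left_mono[OF norm_superposition_le[OF bound, of t] norm_ge_zero[of c]]
    unfolding G_def norm_mult by (simp only: mult.assoc)
  have G_0: "G t = 0" if "t < 0" for t
    using superposition_eq_0[OF bound that] by (simp add: G_def)
  define u where "u = (\<lambda>\<psi>\<in>schwartz_space. LINT t|lebesgue. G t * \<psi> t)"
  have "diffracted_wave bc \<phi> \<alpha> F \<rho> \<theta> = u"
    unfolding diffracted_wave_def
  proof (rule inverse_fourier_laplace_eqI)
    show "tempered_distribution u"
      unfolding u_def by (rule tempered_distribution_of_function[OF G_meas G_le])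
    show "supported_in u {0..}"
      unfolding u_def by (rule supported_in_of_function[OF G_0])
    fix \<omega> :: complex assume \<omega>: "Im \<omega> > 0"
    let ?e = "\<lambda>t. exp (\<i> * \<omega> * complex_of_real t)"
    have "fourier_laplace u \<omega> = (LINT t|lborel. ?e t * G t)"
      unfolding u_def by (rule fourier_laplace_of_function[OF G_meas G_le G_0 \<omega>])
    also have "\<dots> = c * (LINT t|lborel. ?e t * (LINT \<beta>|lborel. Z \<beta> * F0 (t - \<rho> * cosh \<beta>)))"
      unfolding G_def by (simp add: mult.left_commute)
    also have "\<dots> = c * ((LINT s|lborel. ?e s * F0 s) * (LINT \<beta>|lborel. ?e (\<rho> * cosh \<beta>) * Z \<beta>))"
      using fourier_laplace_superposition[OF bound \<omega>] by (rule arg_cong)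
    also have "\<dots> = (LINT s|lborel. ?e s * F0 s) * (c * (LINT \<beta>|lborel. ?e (\<rho> * cosh \<beta>) * Z \<beta>))"
      by (rule mult.left_commute)
    also have "(LINT s|lborel. ?e s * F0 s) = fourier_laplace_fun F \<omega>"
    proof -
      have e_meas: "?e \<in> borel_measurable lborel" by measurable
      have "(LINT s|lborel. ?e s * F0 s) = (LINT s|lebesgue. ?e s * F0 s)"
        by (rule integral_completion[symmetric]) measurable
      also have "\<dots> = (LINT s|lebesgue. ?e s * F s)"
      proof (rule integral_cong_AE)
        show "(\<lambda>s. ?e s * F0 s) \<in> borel_measurable lebesgue"
          by (rule measurable_completion) measurable
        show "(\<lambda>s. ?e s * F s) \<in> borel_measurable lebesgue"
          by (intro borel_measurable_times F_meas measurable_completion e_meas)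
        show "AE s in lebesgue. ?e s * F0 s = ?e s * F s"
        proof (rule AE_I')
          show "N \<in> null_sets lebesgue" using N(1) by (simp add: negligible_iff_null_sets)
        qed (use F0_eq in fastforce)
      qed
      finally show ?thesis by (simp add: fourier_laplace_fun_def)
    qed
    also have "c * (LINT \<beta>|lborel. ?e (\<rho> * cosh \<beta>) * Z \<beta>) = diffraction_amplitude bc \<phi> \<alpha> \<rho> \<theta> \<omega>"
    proof -
      have "(LINT \<beta>|lborel. ?e (\<rho> * cosh \<beta>) * Z \<beta>) = (LINT \<beta>|lebesgue. ?e (\<rho> * cosh \<beta>) * Z \<beta>)"
        by (rule integral_completion[symmetric]) measurable
      then show ?thesis by (simp only: diffraction_amplitude_def c_def Z_def)
    qed
    finally show "fourier_laplace u \<omega> = fourier_laplace_fun F \<omega> * diffraction_amplitude bc \<phi> \<alpha> \<rho> \<theta> \<omega>" .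
  qed
  moreover have "given_by_function u G"
    unfolding u_def by (rule tempered_distribution_of_function[OF G_meas G_le])
  moreover have "G = (\<lambda>t. c * (LINT \<beta>|lebesgue. Z \<beta> * F (t - \<rho> * cosh \<beta>)))"
    using G by (rule ext)
  ultimately show ?thesis
    using int by (simp add: c_def Z_def)
qed

end
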